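(* Let $f(x)\in\mathbf{Z}[x]$ be a separable nonconstant polynomial, and consider the assertion ( * ) for all but finitely many primes $p$, the set $\mathcal{S}(f)$ contains infinitely many elements from every nonzero residue class modulo $p$. Assertion ( * ) holds unconditionally if $f(x)$ has degree 1 or 2. If $f(x)$ has degree 3, or if it has degree 4 and has a rational root, then ( * ) follows from the Parity Conjecture.
   Context: Squarefree integers may be negative and are nonzero. For a nonzero rational number $r$, its squarefree part $S(r)$ is the unique squarefree integer $d$ such that $r/d$ is a square in $\mathbf{Q}$. For a separable nonconstant $f(x)\in\mathbf{Z}[x]$, $\mathcal{S}(f)=\{S(f(r)) : r\in\mathbf{Q},\ f(r)\neq 0\}$. For an elliptic curve $E: y^2=g(x)$ over $\mathbf{Q}$ and a squarefree integer $d$, $E_d: dy^2=g(x)$ denotes the quadratic twist of $E$ by $d$. The Parity Conjecture is used in the following form, for quadratic twists: Let $E$ be an elliptic curve over $\mathbf{Q}$ with conductor $N_E$, and let $d$ be a squarefree integer coprime to $2N_E$. Then $(-1)^{\operatorname{rank} E_d(\mathbf{Q})}=(-1)^{\operatorname{rank} E(\mathbf{Q})}\cdot\chi_d(-N_E)$, where $\chi_d$ is the quadratic Dirichlet character associated to the field $\mathbf{Q}(\sqrt d)$. Here, if $D$ is the discriminant of $\mathbf{Q}(\sqrt d)$, $\chi_d$ is given by the Kronecker symbol $\chi_d(n)=\left(\frac{D}{n}\right)$. *)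

theory Defs
  imports
    Complex_Main
    "HOL-Library.FuncSet"
    "HOL-Computational_Algebra.Computational_Algebra"
    "HOL-Number_Theory.Number_Theory"
    "HOL-Algebra.Generated_Fields"
    "HOL-Algebra.Ideal_Product"
begin

hide_const (open) up_ring.coeff up_ring.monom

section \<open>Squarefree parts of polynomial values\<close>

text \<open>The library's \<open>squarefree\<close> on the integers admits negative integers and excludes 0.\<close>

definition sqfree_part_rat :: "rat \<Rightarrow> int" where
  "sqfree_part_rat r = (THE d. squarefree d \<and> (\<exists>q::rat. r / of_int d = q\<^sup>2))"

definition sqfree_values :: "int poly \<Rightarrow> int set" where
  "sqfree_values f =
     {sqfree_part_rat (poly (map_poly of_int f) r) | r::rat. poly (map_poly of_int f) r \<noteq> 0}"

definition separable_int_poly :: "int poly \<Rightarrow> bool" where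
  "separable_int_poly f \<longleftrightarrow> rsquarefree (map_poly of_int f :: complex poly)"

definition all_residues_for_almost_all_primes :: "int poly \<Rightarrow> bool" where
  "all_residues_for_almost_all_primes f \<longleftrightarrow>
     finite {p::nat. prime p \<and>
       \<not> (\<forall>a::int. \<not> [a = 0] (mod int p) \<longrightarrow> infinite {s \<in> sqfree_values f. [s = a] (mod int p)})}"


section \<open>Elliptic curves and their quadratic twists\<close>

text \<open>
  An elliptic curve over the rationals is given by an equation \<open>y\<^sup>2 = g(x)\<close> with \<open>g\<close> a
  monic separable cubic over the rationals; up to isomorphism, every elliptic curve over the
  rationals has such an equation.
\<close>

definition elliptic_cubic :: "rat poly \<Rightarrow> bool" where
  "elliptic_cubic g \<longleftrightarrow>
     degree g = 3 \<and> lead_coeff g = 1 \<and> rsquarefree (map_poly of_rat g :: complex poly)"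

datatype 'a point = Infinity | Affine 'a 'a

fun on_curve :: "'a::field \<Rightarrow> 'a poly \<Rightarrow> 'a point \<Rightarrow> bool" where
  "on_curve d g Infinity \<longleftrightarrow> True"
| "on_curve d g (Affine x y) \<longleftrightarrow> d * y\<^sup>2 = poly g x"

text \<open>
  The chord-and-tangent law on the curve \<open>d y\<^sup>2 = g(x)\<close>. The slope of the tangent is
  \<open>g'(x) / (2 d y)\<close>; substituting the line \<open>y = l x + m\<close> into the equation gives a monic
  cubic in \<open>x\<close> whose roots add up to \<open>d l\<^sup>2 - coeff g 2\<close>.
\<close>

fun curve_add :: "'a::field \<Rightarrow> 'a poly \<Rightarrow> 'a point \<Rightarrow> 'a point \<Rightarrow> 'a point" where
  "curve_add d g Infinity Q = Q"
| "curve_add d g (Affine x1 y1) Infinity = Affine x1 y1"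
| "curve_add d g (Affine x1 y1) (Affine x2 y2) =
     (if x1 = x2 \<and> y1 = - y2 then Infinity
      else
        let l = (if x1 = x2 then poly (pderiv g) x1 / (2 * d * y1) else (y2 - y1) / (x2 - x1));
            x3 = d * l\<^sup>2 - coeff g 2 - x1 - x2
        in Affine x3 (- (y1 + l * (x3 - x1))))"

definition curve_group :: "'a::field \<Rightarrow> 'a poly \<Rightarrow> 'a point monoid" where
  "curve_group d g =
     \<lparr>carrier = {P. on_curve d g P}, monoid.mult = curve_add d g, one = Infinity\<rparr>"

text \<open>Integral independence and rank in an abelian group of finite rank, written multiplicatively.\<close>

definition int_independent :: "('a, 'b) monoid_scheme \<Rightarrow> 'a set \<Rightarrow> bool" where
  "int_independent G S \<longleftrightarrow> finite S \<and> S \<subseteq> carrier G \<and>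
     (\<forall>n::'a \<Rightarrow> int. finprod G (\<lambda>P. P [^]\<^bsub>G\<^esub> n P) S = \<one>\<^bsub>G\<^esub> \<longrightarrow> (\<forall>P\<in>S. n P = 0))"

definition group_rank :: "('a, 'b) monoid_scheme \<Rightarrow> nat" where
  "group_rank G = Sup {card S | S. int_independent G S}"

text \<open>The rank of the group of rational points of \<open>E\<^sub>d: d y\<^sup>2 = g(x)\<close>.\<close>

definition twist_rank :: "rat poly \<Rightarrow> int \<Rightarrow> nat" where
  "twist_rank g d = group_rank (curve_group (of_int d) g)"


section \<open>Minimal Weierstrass equations and reduction types\<close>

text \<open>\<open>y\<^sup>2 + a\<^sub>1 x y + a\<^sub>3 y = x\<^sup>3 + a\<^sub>2 x\<^sup>2 + a\<^sub>4 x + a\<^sub>6\<close>\<close>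

datatype weierstrass = Weierstrass (wa1: rat) (wa2: rat) (wa3: rat) (wa4: rat) (wa6: rat)

definition wb2 :: "weierstrass \<Rightarrow> rat" where "wb2 W = (wa1 W)\<^sup>2 + 4 * wa2 W"
definition wb4 :: "weierstrass \<Rightarrow> rat" where "wb4 W = 2 * wa4 W + wa1 W * wa3 W"
definition wb6 :: "weierstrass \<Rightarrow> rat" where "wb6 W = (wa3 W)\<^sup>2 + 4 * wa6 W"
definition wb8 :: "weierstrass \<Rightarrow> rat" where
  "wb8 W = (wa1 W)\<^sup>2 * wa6 W + 4 * wa2 W * wa6 W - wa1 W * wa3 W * wa4 W
     + wa2 W * (wa3 W)\<^sup>2 - (wa4 W)\<^sup>2"

definition wc4 :: "weierstrass \<Rightarrow> rat" where "wc4 W = (wb2 W)\<^sup>2 - 24 * wb4 W"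
definition wdisc :: "weierstrass \<Rightarrow> rat" where
  "wdisc W = - (wb2 W)\<^sup>2 * wb8 W - 8 * (wb4 W)^3 - 27 * (wb6 W)\<^sup>2 + 9 * wb2 W * wb4 W * wb6 W"

text \<open>
  \<open>W'\<close> arises from \<open>W\<close> by the substitution
  \<open>x = u\<^sup>2 x' + r\<close>, \<open>y = u\<^sup>3 y' + s u\<^sup>2 x' + t\<close>.
\<close>

definition weierstrass_iso :: "weierstrass \<Rightarrow> weierstrass \<Rightarrow> bool" where
  "weierstrass_iso W W' \<longleftrightarrow> (\<exists>u r s t. u \<noteq> 0 \<and>
     u * wa1 W' = wa1 W + 2 * s \<and>
     u^2 * wa2 W' = wa2 W - s * wa1 W + 3 * r - s^2 \<and>
     u^3 * wa3 W' = wa3 W + r * wa1 W + 2 * t \<and>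
     u^4 * wa4 W' = wa4 W - s * wa3 W + 2 * r * wa2 W - (t + r * s) * wa1 W + 3 * r^2 - 2 * s * t \<and>
     u^6 * wa6 W' = wa6 W + r * wa4 W + r^2 * wa2 W + r^3 - t * wa3 W - t^2 - r * t * wa1 W)"

definition weierstrass_of_cubic :: "rat poly \<Rightarrow> weierstrass" where
  "weierstrass_of_cubic g = Weierstrass 0 (coeff g 2) 0 (coeff g 1) (coeff g 0)"

definition p_integral :: "nat \<Rightarrow> rat \<Rightarrow> bool" where
  "p_integral p r \<longleftrightarrow> \<not> int p dvd snd (quotient_of r)"

definition p_divides :: "nat \<Rightarrow> rat \<Rightarrow> bool" where
  "p_divides p r \<longleftrightarrow> p_integral p r \<and> int p dvd fst (quotient_of r)"

text \<open>The \<open>p\<close>-adic valuation of a nonzero \<open>p\<close>-integral rational number.\<close>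

definition p_val :: "nat \<Rightarrow> rat \<Rightarrow> nat" where
  "p_val p r = multiplicity (int p) (fst (quotient_of r))"

definition p_integral_model :: "nat \<Rightarrow> rat poly \<Rightarrow> weierstrass \<Rightarrow> bool" where
  "p_integral_model p g W \<longleftrightarrow> weierstrass_iso (weierstrass_of_cubic g) W \<and>
     (\<forall>a \<in> {wa1 W, wa2 W, wa3 W, wa4 W, wa6 W}. p_integral p a)"

definition p_minimal_model :: "nat \<Rightarrow> rat poly \<Rightarrow> weierstrass \<Rightarrow> bool" where
  "p_minimal_model p g W \<longleftrightarrow> p_integral_model p g W \<and>
     (\<forall>W'. p_integral_model p g W' \<longrightarrow> p_val p (wdisc W) \<le> p_val p (wdisc W'))"

definition good_reduction :: "nat \<Rightarrow> rat poly \<Rightarrow> bool" where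
  "good_reduction p g \<longleftrightarrow> (\<exists>W. p_minimal_model p g W \<and> \<not> p_divides p (wdisc W))"

definition multiplicative_reduction :: "nat \<Rightarrow> rat poly \<Rightarrow> bool" where
  "multiplicative_reduction p g \<longleftrightarrow>
     (\<exists>W. p_minimal_model p g W \<and> p_divides p (wdisc W) \<and> \<not> p_divides p (wc4 W))"


section \<open>The conductor\<close>

definition complex_ring :: "complex ring" where
  "complex_ring = \<lparr>carrier = UNIV, monoid.mult = (*), one = 1, ring.zero = 0, add = (+)\<rparr>"

definition torsion_points :: "nat \<Rightarrow> rat poly \<Rightarrow> complex point set" where
  "torsion_points m g =
     (let E = curve_group 1 (map_poly of_rat g)
      in {P \<in> carrier E. P [^]\<^bsub>E\<^esub> m = \<one>\<^bsub>E\<^esub>})"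

definition torsion_field :: "nat \<Rightarrow> rat poly \<Rightarrow> complex set" where
  "torsion_field m g = generate_field complex_ring (\<Union>P\<in>torsion_points m g. set_point P)"

text \<open>
  Field automorphisms of a subfield \<open>L\<close> of the complex numbers, made unique as functions on all
  complex numbers by \<open>extensional\<close>. They fix the rational numbers.
\<close>

definition galois_group :: "complex set \<Rightarrow> (complex \<Rightarrow> complex) set" where
  "galois_group L =
     ring_iso (complex_ring\<lparr>carrier := L\<rparr>) (complex_ring\<lparr>carrier := L\<rparr>) \<inter> extensional L"

definition integers_of :: "complex set \<Rightarrow> complex ring" where
  "integers_of L = complex_ring\<lparr>carrier := {x \<in> L. algebraic_int x}\<rparr>"

definition prime_above :: "nat \<Rightarrow> complex set \<Rightarrow> complex set" where
  "prime_above p L = (SOME I. primeideal I (integers_of L) \<and> of_nat p \<in> I)"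

definition ideal_power :: "complex ring \<Rightarrow> complex set \<Rightarrow> nat \<Rightarrow> complex set" where
  "ideal_power R I n = (ideal_prod R I ^^ n) (carrier R)"

text \<open>
  The \<open>i\<close>-th ramification group, in the lower numbering, of the chosen prime \<open>I\<close> of \<open>L\<close> above \<open>p\<close>.
  Its elements lie in the decomposition group of \<open>I\<close>, so this is also the ramification group of
  the completion of \<open>L\<close> at \<open>I\<close> over the \<open>p\<close>-adic numbers; for \<open>i = 0\<close> it is the inertia group.
\<close>

definition ramification_group :: "nat \<Rightarrow> complex set \<Rightarrow> nat \<Rightarrow> (complex \<Rightarrow> complex) set" where
  "ramification_group p L i =
     {\<sigma> \<in> galois_group L. \<forall>x \<in> carrier (integers_of L).
        \<sigma> x - x \<in> ideal_power (integers_of L) (prime_above p L) (i + 1)}"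

definition fixed_points :: "complex point set \<Rightarrow> (complex \<Rightarrow> complex) set \<Rightarrow> complex point set" where
  "fixed_points T H = {P \<in> T. \<forall>\<sigma>\<in>H. map_point \<sigma> P = P}"

text \<open>
  The wild part of the conductor exponent,
  \<open>\<delta> = \<Sum>i\<ge>1. |G\<^sub>i| / |G\<^sub>0| \<cdot> dim (E[l] / E[l]\<^bsup>G\<^sub>i\<^esup>)\<close>,
  the dimension being over the field with \<open>l\<close> elements. Here \<open>G\<^sub>i\<close> are the ramification groups
  at \<open>p\<close> of the field generated by the coordinates of the points of \<open>E[l]\<close>, and \<open>l\<close> may be any
  prime different from \<open>p\<close>. The value does not depend on \<open>l\<close> nor on the prime above \<open>p\<close>, only
  finitely many summands are nonzero, and the sum is an integer.
\<close>

definition wild_exponent :: "nat \<Rightarrow> rat poly \<Rightarrow> real" where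
  "wild_exponent p g =
     (let l = (if p = 2 then 3 else 2);
          T = torsion_points l g;
          G = ramification_group p (torsion_field l g)
      in \<Sum>i. real (card (G (Suc i))) / real (card (G 0))
                * log (real l) (real (card T) / real (card (fixed_points T (G (Suc i))))))"

definition conductor_exponent :: "nat \<Rightarrow> rat poly \<Rightarrow> nat" where
  "conductor_exponent p g =
     (if good_reduction p g then 0
      else if multiplicative_reduction p g then 1
      else 2 + nat \<lfloor>wild_exponent p g\<rfloor>)"

definition conductor :: "rat poly \<Rightarrow> nat" where
  "conductor g = (\<Prod>p \<in> {p. prime p \<and> \<not> good_reduction p g}. p ^ conductor_exponent p g)"


section \<open>Quadratic characters and the Parity Conjecture\<close>

definition kronecker_prime :: "int \<Rightarrow> int \<Rightarrow> int" where
  "kronecker_prime a p =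
     (if p = 2 then (if even a then 0 else if a mod 8 = 1 \<or> a mod 8 = 7 then 1 else - 1)
      else Legendre a p)"

definition kronecker :: "int \<Rightarrow> int \<Rightarrow> int" where
  "kronecker a n =
     (if n = 0 then (if \<bar>a\<bar> = 1 then 1 else 0)
      else (if n < 0 \<and> a < 0 then - 1 else 1)
             * (\<Prod>p\<in>prime_factors n. kronecker_prime a p ^ multiplicity p n))"

text \<open>The discriminant of the field generated by \<open>\<surd>d\<close>, for a squarefree integer \<open>d\<close>.\<close>

definition quadratic_disc :: "int \<Rightarrow> int" where
  "quadratic_disc d = (if [d = 1] (mod 4) then d else 4 * d)"

definition quadratic_character :: "int \<Rightarrow> int \<Rightarrow> int" where
  "quadratic_character d n = kronecker (quadratic_disc d) n"

text \<open>
  If \<open>d\<close> is congruent to 3 modulo 4 and the conductor \<open>N\<close> is even, then \<open>\<chi>\<^sub>d(-N) = 0\<close> even when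
  \<open>d\<close> is coprime to \<open>2 N\<close>, and the predicted identity of signs cannot hold. The conjecture
  concerns those \<open>d\<close> for which the discriminant of the quadratic field is coprime to \<open>N\<close>; this
  condition is therefore included, and it excludes precisely these degenerate cases.
\<close>

definition parity_conjecture :: bool where
  "parity_conjecture \<longleftrightarrow>
     (\<forall>g d. elliptic_cubic g \<and> squarefree d \<and> coprime d (2 * int (conductor g)) \<and>
        coprime (quadratic_disc d) (int (conductor g)) \<longrightarrow>
        (- 1) ^ twist_rank g d = (- 1) ^ twist_rank g 1 * quadratic_character d (- int (conductor g)))"

end

theory Submission
  imports Defs "HOL-Library.Discrete_Functions"
begin

text \<open>
  In every degree the residue class of a value is prescribed by congruences, and squarefree values
  in that class come from a sieve. In degree 1 every squarefree integer is a value up to squares;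
  in degree 2 the values are, up to squares, the numbers \<open>A (u\<^sup>2 - D v\<^sup>2)\<close>.

  For a cubic, made monic, take \<open>d \<equiv> 1\<close> modulo \<open>8 N\<close>, where \<open>N\<close> is the conductor. Then
  \<open>\<chi>\<^sub>d(-N)\<close> is the sign of \<open>d\<close>, so for one choice of sign the Parity Conjecture makes the rank of
  \<open>E\<^sub>d\<close> odd, whatever the residue of \<open>d\<close> modulo a prime not dividing \<open>2 N\<close>. Positive rank yields a
  point with \<open>y \<noteq> 0\<close>, that is, a value \<open>d y\<^sup>2\<close> of the cubic. Nothing about \<open>N\<close> is used except
  \<open>N > 0\<close>. A quartic with a rational root \<open>r\<close> becomes a cubic under \<open>x = r + 1/t\<close>.
\<close>

section \<open>Squarefree parts of values\<close>

text \<open>If squarefree \<open>d\<close> and \<open>e\<close> differ by the square of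
  \<open>m / n\<close> in lowest terms, then \<open>e * n^2 = d * m^2\<close>. Coprimality gives
  \<open>m^2 dvd e\<close> and \<open>n^2 dvd d\<close>, so \<open>m\<close> and \<open>n\<close>
  are units. This evaluates the definite description.\<close>

lemma sqfree_part_rat_eqI:
  fixes d :: int and q r :: rat
  assumes "squarefree d" "r = of_int d * q\<^sup>2" "q \<noteq> 0"
  shows "sqfree_part_rat r = d"
  unfolding sqfree_part_rat_def
proof (rule the_equality)
  have "d \<noteq> 0" using assms(1) by auto
  then show "squarefree d \<and> (\<exists>q. r / of_int d = q\<^sup>2)"
    using assms by auto
next
  fix e :: int
  assume e: "squarefree e \<and> (\<exists>q. r / of_int e = q\<^sup>2)"
  then obtain s where s: "r / of_int e = s\<^sup>2" by blast
  have nz: "d \<noteq> 0" "e \<noteq> 0" using assms(1) e by auto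
  have r: "r = of_int e * s\<^sup>2" using s nz by (simp add: field_simps)
  have "r \<noteq> 0" using assms nz by simp
  then have "s \<noteq> 0" using r by auto
  obtain m n where mn: "quotient_of (q / s) = (m, n)" by (cases "quotient_of (q / s)")
  have n: "n > 0" and co: "coprime m n" and qs: "q / s = of_int m / of_int n"
    using mn quotient_of_denom_pos quotient_of_coprime quotient_of_div by blast+
  have "of_int e = (of_int d * (q / s)\<^sup>2 :: rat)"
    using r assms(2) \<open>s \<noteq> 0\<close> by (simp add: field_simps)
  then have "of_int (e * n\<^sup>2) = (of_int (d * m\<^sup>2) :: rat)"
    using n by (simp add: qs field_simps)
  then have eq: "e * n\<^sup>2 = d * m\<^sup>2" by (simp only: of_int_eq_iff)
  have "coprime (m\<^sup>2) (n\<^sup>2)" using co by simp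
  then have "m\<^sup>2 dvd e" "n\<^sup>2 dvd d"
    using eq by (metis coprime_commute coprime_dvd_mult_left_iff coprime_dvd_mult_right_iff dvd_triv_right)+
  then have "m dvd 1" "n dvd 1" using assms(1) e squarefreeD by blast+
  then have "m\<^sup>2 = 1" "n\<^sup>2 = 1" by (auto simp: power2_eq_1_iff abs_if split: if_splits)
  then show "e = d" using eq by simp
qed

lemma sqfree_valuesI:
  fixes d :: int and q r :: rat
  assumes "squarefree d" "poly (map_poly of_int f) r = of_int d * q\<^sup>2" "q \<noteq> 0"
  shows "d \<in> sqfree_values f"
proof -
  have "d \<noteq> 0" using assms(1) by auto
  then have "poly (map_poly of_int f) r \<noteq> 0" using assms by simp
  moreover have "sqfree_part_rat (poly (map_poly of_int f) r) = d"
    using sqfree_part_rat_eqI assms by blast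
  ultimately show ?thesis unfolding sqfree_values_def by blast
qed

section \<open>The primes have density zero\<close>

lemma prod_primes_dvd:
  fixes m :: nat
  assumes "finite A" "\<And>q. q \<in> A \<Longrightarrow> prime q \<and> q dvd m"
  shows "(\<Prod>q\<in>A. q) dvd m"
  using assms
proof (induction A rule: finite_induct)
  case (insert q A)
  have "coprime q (\<Prod>A)"
    by (rule prod_coprime_right) (metis insert.hyps(2) insert.prems insertCI primes_coprime)
  then show ?case using insert by (simp add: divides_mult)
qed simp

definition primes_le :: "nat \<Rightarrow> nat set" where
  "primes_le n = {q. prime q \<and> q \<le> n}"

lemma finite_primes_le [simp]: "finite (primes_le n)"
  unfolding primes_le_def by simp

text \<open>Chebyshev's argument: every prime between \<open>n\<close> and \<open>2 * n\<close>
  divides the central binomial coefficient, which is at most \<open>4 ^ n\<close>, and each of these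
  primes exceeds \<open>n\<close>.\<close>

lemma card_primes_le_double:
  assumes "n > 0"
  shows "n ^ (card (primes_le (2 * n)) - card (primes_le n)) \<le> 4 ^ n"
proof -
  let ?P = "primes_le (2 * n) - primes_le n"
  have sub: "primes_le n \<subseteq> primes_le (2 * n)" by (auto simp: primes_le_def)
  then have c: "card ?P = card (primes_le (2 * n)) - card (primes_le n)"
    by (simp add: card_Diff_subset)
  have dv: "q dvd (2 * n choose n)" if "q \<in> ?P" for q
  proof -
    have q: "prime q" "q > n" "q \<le> 2 * n" using that by (auto simp: primes_le_def)
    have "fact n * fact n * (2 * n choose n) = (fact (2 * n) :: nat)"
      using binomial_fact_lemma[of n "2 * n"] by simp
    moreover have "q dvd fact (2 * n)" "\<not> q dvd fact n"
      using q by (simp_all add: prime_dvd_fact_iff)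
    ultimately show ?thesis using q by (metis prime_dvd_mult_iff)
  qed
  have "(\<Prod>q\<in>?P. q) dvd (2 * n choose n)"
    by (rule prod_primes_dvd) (use dv in \<open>auto simp: primes_le_def\<close>)
  then have "(\<Prod>q\<in>?P. q) \<le> (2 * n choose n)" by (simp add: dvd_imp_le)
  also have "\<dots> \<le> (\<Sum>k\<le>2*n. (2 * n choose k))" by (rule member_le_sum) auto
  also have "\<dots> = 4 ^ n" by (simp add: choose_row_sum power_mult)
  finally have "(\<Prod>q\<in>?P. q) \<le> 4 ^ n" .
  moreover have "(\<Prod>q\<in>?P. n) \<le> (\<Prod>q\<in>?P. q)"
    by (rule prod_mono) (auto simp: primes_le_def)
  ultimately show ?thesis using c by simp
qed

lemma card_primes_le_mono: "m \<le> n \<Longrightarrow> card (primes_le m) \<le> card (primes_le n)"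
  by (rule card_mono) (auto simp: primes_le_def)

lemma card_primes_le_le: "card (primes_le n) \<le> n"
proof -
  have "primes_le n \<subseteq> {1..n}" by (auto simp: primes_le_def dest: prime_gt_0_nat)
  then show ?thesis using card_mono[of "{1..n}"] by fastforce
qed

text \<open>This is pi(x) = O(x / log x) at powers of 2, by induction on the dyadic estimate. The
  constant 6 is large enough for the induction to close; the first cases follow from pi(x) <=
  x.\<close>

lemma card_primes_le_power2: "j * card (primes_le (2 ^ j)) \<le> 6 * 2 ^ j"
proof (induction j)
  case (Suc j)
  let ?a = "card (primes_le (2 ^ j))" and ?b = "card (primes_le (2 ^ Suc j))"
  show ?case
  proof (cases "j < 2")
    case True
    then have "Suc j \<le> 2" by simp
    then have "Suc j * ?b \<le> 2 * 2 ^ Suc j"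
      using card_primes_le_le by (rule mult_le_mono)
    then show ?thesis by simp
  next
    case False
    have "2 ^ (j * (?b - ?a)) \<le> (2::nat) ^ (2 * 2 ^ j)"
      using card_primes_le_double[of "2 ^ j"] by (simp add: power_mult)
    then have "j * (?b - ?a) \<le> 2 * 2 ^ j" by (simp only: power_increasing_iff one_less_numeral_iff semiring_norm(76))
    moreover have "?a \<le> ?b" by (rule card_primes_le_mono) simp
    then have "j * ?b = j * (?b - ?a) + j * ?a" by (simp flip: add_mult_distrib2)
    ultimately have "j * ?b \<le> 8 * 2 ^ j" using Suc by linarith
    \<comment> \<open>For \<open>j\<close> at least 2, replacing \<open>j\<close> by
      \<open>Suc j\<close> costs a factor of at most 3/2, which turns 8 into 12, twice the constant
      6.\<close>
    moreover have "2 * Suc j * ?b \<le> 3 * j * ?b" using False by (intro mult_le_mono1) simp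
    ultimately have "2 * (Suc j * ?b) \<le> 3 * (8 * 2 ^ j)" by (simp only: mult.assoc)
    then show ?thesis by simp
  qed
qed simp

text \<open>With \<open>x\<close> between \<open>2 ^ j\<close> and \<open>2 ^ Suc j\<close>, the
  hypothesis gives \<open>12 * c <= Suc j\<close>, and the dyadic bound at \<open>Suc j\<close> is
  at most \<open>12 * x\<close>.\<close>

lemma card_primes_le_negligible:
  assumes "2 ^ (12 * c) \<le> x"
  shows "c * card (primes_le x) \<le> x"
proof -
  have "x > 0" using assms by (metis not_gr_zero le_zero_eq power_not_zero zero_neq_numeral)
  define j :: nat where "j = floor_log x"
  have j: "2 ^ j \<le> x" "x < 2 ^ Suc j"
    unfolding j_def using \<open>x > 0\<close> floor_log_exp2_le floor_log_exp2_gt by auto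
  have "(2::nat) ^ (12 * c) < 2 ^ Suc j" using assms j by linarith
  then have "12 * c \<le> Suc j" by (simp only: power_strict_increasing_iff one_less_numeral_iff semiring_norm(76))
  then have "12 * c * card (primes_le x) \<le> Suc j * card (primes_le (2 ^ Suc j))"
    using j by (intro mult_le_mono card_primes_le_mono) auto
  also have "\<dots> \<le> 12 * 2 ^ j" using card_primes_le_power2[of "Suc j"] by simp
  also have "\<dots> \<le> 12 * x" using j by simp
  finally show ?thesis by simp
qed

section \<open>A squarefree sieve\<close>

text \<open>Since (2i+1)^2 >= 4i(i+1), the sum is dominated by a telescoping one. The induction
  needs the sharper bound with the term 1/(n+1) subtracted.\<close>

lemma sum_inverse_odd_squares: "(\<Sum>i=1..n. 1 / (2 * real i + 1)\<^sup>2) \<le> 1/4"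
proof -
  have "(\<Sum>i=1..n. 1 / (2 * real i + 1)\<^sup>2) \<le> (1 - 1 / (real n + 1)) / 4"
  proof (induction n)
    case (Suc n)
    have "4 * (real n + 1) * (real n + 2) \<le> (2 * real (Suc n) + 1)\<^sup>2"
      by (simp add: power2_eq_square algebra_simps)
    then have "1 / (2 * real (Suc n) + 1)\<^sup>2 \<le> 1 / (4 * (real n + 1) * (real n + 2))"
      by (intro frac_le) auto
    also have "\<dots> = (1 / (real n + 1) - 1 / (real (Suc n) + 1)) / 4"
      by (simp add: field_simps)
    finally show ?case using Suc by simp
  qed simp
  also have "\<dots> \<le> 1/4" by simp
  finally show ?thesis .
qed

text \<open>Within one class, \<open>k\<close> is determined by \<open>k div m\<close>.\<close>

lemma card_residue_class_le:
  fixes K m r :: nat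
  shows "card {k. k < K \<and> k mod m = r} \<le> K div m + 1"
proof -
  have "card {k. k < K \<and> k mod m = r} \<le> card {..K div m}"
  proof (rule card_inj_on_le)
    show "inj_on (\<lambda>k. k div m) {k. k < K \<and> k mod m = r}"
      by (rule inj_onI) (metis (mono_tags, lifting) div_mult_mod_eq mem_Collect_eq)
  qed (auto intro!: div_le_mono)
  then show ?thesis by simp
qed

text \<open>Odd primes are among 3, 5, 7 and so on. Including 2 would double the bound, and with two
  classes per prime the main term of the sieve would grow to all of \<open>K\<close>.\<close>

lemma sum_inverse_odd_primes_squared:
  "(\<Sum>q\<in>primes_le n - {2}. 1 / (real q)\<^sup>2) \<le> 1/4"
proof -
  have sub: "primes_le n - {2} \<subseteq> (\<lambda>i. 2 * i + 1) ` {1..n}"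
  proof
    fix q assume "q \<in> primes_le n - {2}"
    then have q: "prime q" "q \<noteq> 2" "q \<le> n" by (auto simp: primes_le_def)
    then have "odd q" "q > 1" using prime_odd_nat prime_gt_1_nat[of q] prime_ge_2_nat[of q] by force+
    then obtain i where "q = 2 * i + 1" by (auto elim: oddE)
    then show "q \<in> (\<lambda>i. 2 * i + 1) ` {1..n}" using q \<open>q > 1\<close> by auto
  qed
  have "(\<Sum>q\<in>primes_le n - {2}. 1 / (real q)\<^sup>2) \<le> (\<Sum>q\<in>(\<lambda>i. 2 * i + 1) ` {1..n}. 1 / (real q)\<^sup>2)"
    by (rule sum_mono2) (use sub in auto)
  also have "\<dots> = (\<Sum>i=1..n. 1 / (2 * real i + 1)\<^sup>2)"
    by (subst sum.reindex) (auto simp: inj_on_def add_ac)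
  also note sum_inverse_odd_squares
  finally show ?thesis .
qed

text \<open>
  Among \<open>k < K\<close>, an odd prime \<open>q\<close> spoils at most \<open>2 (K / q\<^sup>2 + 1)\<close> values, and only
  \<open>q = O(K)\<close> matter. The main terms add up to at most \<open>K / 2\<close> and the terms 2 to at most
  \<open>2 \<pi>(O(K)) = o(K)\<close>.
\<close>

lemma infinite_squarefree_values:
  fixes h :: "nat \<Rightarrow> int" and B :: nat
  assumes nz: "\<And>k. h k \<noteq> 0" and bound: "\<And>k. \<bar>h k\<bar> \<le> (int B * (int k + 1))\<^sup>2"
    and two: "\<And>k. \<not> 2\<^sup>2 dvd h k"
    and loc: "\<And>q. prime q \<Longrightarrow> q \<noteq> 2 \<Longrightarrow>
      \<exists>r s. \<forall>k. (int q)\<^sup>2 dvd h k \<longrightarrow> k mod q\<^sup>2 = r \<or> k mod q\<^sup>2 = s"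
  shows "infinite {k. squarefree (h k)}"
proof
  assume fin: "finite {k. squarefree (h k)}" (is "finite ?S")
  \<comment> \<open>The power of 2 lets \<open>card_primes_le_negligible\<close> apply with constant
    \<open>8 * (B + 1)\<close>; the summand \<open>4 * card ?S + 1\<close> contradicts the final
    estimate.\<close>
  define K where "K = 4 * card ?S + 1 + 2 ^ (12 * (8 * (B + 1)))"
  define P where "P = primes_le ((B + 1) * K) - {2}"
  have cover: "{..<K} \<subseteq> ?S \<union> (\<Union>q\<in>P. {k. k < K \<and> (int q)\<^sup>2 dvd h k})"
  proof
    fix k assume k: "k \<in> {..<K}"
    show "k \<in> ?S \<union> (\<Union>q\<in>P. {k. k < K \<and> (int q)\<^sup>2 dvd h k})"
    proof (cases "squarefree (h k)")
      case False
      then obtain p where p: "prime p" "p\<^sup>2 dvd h k"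
        using squarefree_factorial_semiring[OF nz[of k]] by auto
      define q where "q = nat p"
      have q: "prime q" "p = int q" using p(1) by (simp_all add: q_def prime_ge_0_int)
      have "q \<noteq> 2" using two[of k] p q by auto
      \<comment> \<open>The quadratic growth bound on \<open>h\<close> enters here: a square
        dividing \<open>h k\<close> has root at most linear in \<open>k\<close>, so \<open>q\<close>
        lies in \<open>P\<close>.\<close>
      have "(int q)\<^sup>2 \<le> \<bar>h k\<bar>" using p q nz[of k] by (metis dvd_abs_iff zdvd_imp_le zero_less_abs_iff)
      also have "\<dots> \<le> (int B * (int k + 1))\<^sup>2" by (rule bound)
      finally have "int q \<le> int B * (int k + 1)" by (rule power2_le_imp_le) simp
      also have "\<dots> = int (B * (k + 1))" by (simp add: algebra_simps)
      finally have "q \<le> B * (k + 1)" by (simp only: of_nat_le_iff)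
      also have "\<dots> \<le> (B + 1) * K" using k by (intro mult_le_mono) auto
      finally have "q \<in> P" using q \<open>q \<noteq> 2\<close> by (simp add: P_def primes_le_def)
      then show ?thesis using k p q by auto
    qed simp
  qed
  have each: "real (card {k. k < K \<and> (int q)\<^sup>2 dvd h k}) \<le> 2 * real K * (1 / (real q)\<^sup>2) + 2"
    if "q \<in> P" for q
  proof -
    have "prime q" "q \<noteq> 2" using that by (auto simp: P_def primes_le_def)
    then obtain r s where rs: "\<forall>k. (int q)\<^sup>2 dvd h k \<longrightarrow> k mod q\<^sup>2 = r \<or> k mod q\<^sup>2 = s"
      using loc by blast
    have "card {k. k < K \<and> (int q)\<^sup>2 dvd h k}
        \<le> card ({k. k < K \<and> k mod q\<^sup>2 = r} \<union> {k. k < K \<and> k mod q\<^sup>2 = s})"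
      by (rule card_mono) (use rs in auto)
    also have "\<dots> \<le> (K div q\<^sup>2 + 1) + (K div q\<^sup>2 + 1)"
      by (rule order_trans[OF card_Un_le add_mono]) (rule card_residue_class_le)+
    finally have "real (card {k. k < K \<and> (int q)\<^sup>2 dvd h k}) \<le> real (2 * (K div q\<^sup>2) + 2)"
      by linarith
    also have "\<dots> \<le> 2 * (real K / real (q\<^sup>2)) + 2"
      using of_nat_div_le_of_nat[of K "q\<^sup>2", where ?'a = real] by linarith
    finally show ?thesis by simp
  qed
  have "K \<le> card (?S \<union> (\<Union>q\<in>P. {k. k < K \<and> (int q)\<^sup>2 dvd h k}))"
    using card_mono[OF _ cover] fin by (simp add: P_def)
  also have "\<dots> \<le> card ?S + (\<Sum>q\<in>P. card {k. k < K \<and> (int q)\<^sup>2 dvd h k})"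
    by (rule order_trans[OF card_Un_le add_left_mono[OF card_UN_le]]) (simp add: P_def)
  finally have "real K \<le> real (card ?S) + (\<Sum>q\<in>P. real (card {k. k < K \<and> (int q)\<^sup>2 dvd h k}))"
    by (simp flip: of_nat_sum of_nat_add)
  also have "\<dots> \<le> real (card ?S) + (\<Sum>q\<in>P. 2 * real K * (1 / (real q)\<^sup>2) + 2)"
    by (intro add_left_mono sum_mono each)
  also have "\<dots> = real (card ?S) + 2 * real K * (\<Sum>q\<in>P. 1 / (real q)\<^sup>2) + 2 * real (card P)"
    by (simp add: sum.distrib sum_distrib_left)
  \<comment> \<open>The two sums take K/2 and K/4, so a quarter of the \<open>k < K\<close> must be
    squarefree positions.\<close>
  also have "\<dots> \<le> real (card ?S) + 2 * real K * (1/4) + 2 * (real K / 8)"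
  proof (intro add_mono mult_left_mono)
    show "(\<Sum>q\<in>P. 1 / (real q)\<^sup>2) \<le> 1/4"
      unfolding P_def by (rule sum_inverse_odd_primes_squared)
    have "card P \<le> card (primes_le ((B + 1) * K))"
      unfolding P_def by (rule card_mono) auto
    moreover have "8 * (B + 1) * card (primes_le ((B + 1) * K)) \<le> (B + 1) * K"
    proof (rule card_primes_le_negligible)
      have "2 ^ (12 * (8 * (B + 1))) \<le> K" by (simp add: K_def)
      also have "\<dots> \<le> (B + 1) * K" by simp
      finally show "2 ^ (12 * (8 * (B + 1))) \<le> (B + 1) * K" .
    qed
    then have "(B + 1) * (8 * card (primes_le ((B + 1) * K))) \<le> (B + 1) * K"
      by (simp only: ac_simps)
    then have "8 * card (primes_le ((B + 1) * K)) \<le> K"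
      unfolding mult_le_cancel1 by simp
    ultimately show "real (card P) \<le> real K / 8" by linarith
  qed auto
  finally have "real K \<le> 4 * real (card ?S)" by simp
  then have "K \<le> 4 * card ?S" by linarith
  then show False by (simp add: K_def)
qed

section \<open>Squarefree values in residue classes\<close>

lemma cong_nat_int_power2:
  fixes k l q :: nat
  assumes "(int q)\<^sup>2 dvd int k - int l"
  shows "k mod q\<^sup>2 = l mod q\<^sup>2"
proof -
  have "[int k = int l] (mod int (q\<^sup>2))" using assms by (simp add: cong_iff_dvd_diff)
  then have "[k = l] (mod q\<^sup>2)" by (simp only: cong_int_iff)
  then show ?thesis by (simp only: cong_def)
qed

text \<open>Values of \<open>e + M * k\<close> are coprime to \<open>M\<close>. A prime dividing
  \<open>M\<close>, in particular 2, therefore spoils no value, and any other prime spoils a single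
  class modulo its square.\<close>

lemma infinite_squarefree_linear:
  fixes c M :: int
  assumes "M > 0" "even M" "coprime c M"
  shows "infinite {d. d > 0 \<and> squarefree d \<and> [d = c] (mod M)}"
proof -
  define e where "e = c mod M + M"
  have e: "e > 0" "[e = c] (mod M)" using assms(1) by (simp_all add: e_def cong_def add_pos_nonneg add.commute)
  have "coprime e M" using e(2) assms(3) by (meson cong_imp_coprime cong_sym)
  define h where "h k = e + M * int k" for k
  have pos: "h k > 0" for k using e(1) assms(1) by (simp add: h_def add_pos_nonneg)
  have copr: "coprime (h k) M" for k
    by (rule cong_imp_coprime[OF _ \<open>coprime e M\<close>]) (simp add: h_def cong_def)
  have "infinite {k. squarefree (h k)}"
  proof (rule infinite_squarefree_values)
    show "h k \<noteq> 0" for k using pos[of k] by simp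
    show "\<bar>h k\<bar> \<le> (int (nat (e + M)) * (int k + 1))\<^sup>2" for k
    proof -
      have "h k \<le> (e + M) * (int k + 1)" using e(1) assms(1) by (simp add: h_def algebra_simps)
      \<comment> \<open>The sieve is stated for quadratic growth; a linear bound that is at least 1
        is below its own square.\<close>
      also have "\<dots> \<le> ((e + M) * (int k + 1))\<^sup>2"
        by (rule self_le_power) (use e(1) assms(1) in \<open>auto intro!: mult_pos_pos simp: int_one_le_iff_zero_less\<close>)
      finally show ?thesis using pos[of k] e(1) assms(1) by simp
    qed
    show "\<not> 2\<^sup>2 dvd h k" for k
    proof
      assume "2\<^sup>2 dvd h k"
      then have "2 dvd h k" by (rule dvd_trans[rotated]) simp
      then show False using coprime_common_divisor[OF copr[of k], of 2] assms(2) by simp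
    qed
    fix q :: nat
    assume q: "prime q" "q \<noteq> 2"
    show "\<exists>r s. \<forall>k. (int q)\<^sup>2 dvd h k \<longrightarrow> k mod q\<^sup>2 = r \<or> k mod q\<^sup>2 = s"
    proof (cases "\<exists>k. (int q)\<^sup>2 dvd h k")
      case True
      then obtain l where l: "(int q)\<^sup>2 dvd h l" by blast
      have "coprime ((int q)\<^sup>2) M"
        using l copr[of l] by (metis coprime_divisors dvd_refl)
      have "k mod q\<^sup>2 = l mod q\<^sup>2" if "(int q)\<^sup>2 dvd h k" for k
      proof (rule cong_nat_int_power2)
        have "(int q)\<^sup>2 dvd h k - h l" using that l by (rule dvd_diff)
        also have "h k - h l = M * (int k - int l)" by (simp add: h_def algebra_simps)
        finally show "(int q)\<^sup>2 dvd int k - int l"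
          using \<open>coprime ((int q)\<^sup>2) M\<close> by (simp add: coprime_dvd_mult_right_iff)
      qed
      then show ?thesis by blast
    qed blast
  qed
  moreover have "inj h" using assms(1) by (auto simp: inj_def h_def)
  ultimately have "infinite (h ` {k. squarefree (h k)})"
    by (meson finite_imageD inj_on_subset subset_UNIV)
  moreover have "h ` {k. squarefree (h k)} \<subseteq> {d. d > 0 \<and> squarefree d \<and> [d = c] (mod M)}"
    using pos e(2) by (auto simp: h_def cong_def)
  ultimately show ?thesis by (meson finite_subset)
qed

text \<open>If \<open>q\<close> divided both \<open>x - y\<close> and \<open>x + y\<close>, it would
  divide \<open>2 * x\<close>, hence \<open>x\<close> and \<open>E\<close>. So \<open>q^2\<close> is
  coprime to one factor of \<open>x^2 - y^2\<close> and divides the other: \<open>E\<close> has at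
  most two square roots modulo \<open>q^2\<close>.\<close>

lemma square_roots_mod_prime_square:
  fixes q x y E :: int
  assumes "prime q" "\<not> q dvd 2 * E" "q\<^sup>2 dvd x\<^sup>2 - E" "q\<^sup>2 dvd y\<^sup>2 - E"
  shows "q\<^sup>2 dvd x - y \<or> q\<^sup>2 dvd x + y"
proof -
  have "q\<^sup>2 dvd (x\<^sup>2 - E) - (y\<^sup>2 - E)" using assms(3,4) by (rule dvd_diff)
  also have "(x\<^sup>2 - E) - (y\<^sup>2 - E) = (x - y) * (x + y)"
    by (simp add: power2_eq_square algebra_simps)
  finally have dv: "q\<^sup>2 dvd (x - y) * (x + y)" .
  have "\<not> (q dvd x - y \<and> q dvd x + y)"
  proof
    assume "q dvd x - y \<and> q dvd x + y"
    then have "q dvd (x - y) + (x + y)" by (simp only: dvd_add)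
    then have "q dvd 2 * x" by simp
    then have "q dvd x" using assms(1,2) by (metis dvd_mult2 prime_dvd_mult_iff)
    then have "q dvd x\<^sup>2" by (simp add: power2_eq_square)
    moreover have "q dvd x\<^sup>2 - E" using assms(3) by (rule dvd_trans[rotated]) simp
    ultimately have "q dvd x\<^sup>2 - (x\<^sup>2 - E)" by (rule dvd_diff)
    then show False using assms(2) by simp
  qed
  then have "coprime (q\<^sup>2) (x - y) \<or> coprime (q\<^sup>2) (x + y)"
    using assms(1) by (auto intro: prime_imp_coprime)
  then show ?thesis using dv
    by (auto simp: coprime_dvd_mult_right_iff coprime_dvd_mult_left_iff)
qed

text \<open>The values are coprime to \<open>M\<close>, so only primes outside \<open>2 * E\<close>
  can spoil them, and for these the square roots of \<open>E\<close> fill at most two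
  classes.\<close>

lemma infinite_squarefree_quadratic:
  fixes u E M :: int
  assumes "M > 0" and bad: "\<And>q. prime q \<Longrightarrow> q dvd 2 * E \<Longrightarrow> q dvd M"
    and "coprime (u\<^sup>2 - E) M"
  shows "infinite {m. squarefree m \<and> (\<exists>x. [x = u] (mod M) \<and> m = x\<^sup>2 - E)}"
proof -
  \<comment> \<open>This representative of \<open>u\<close> exceeds the absolute value of
    \<open>E\<close>, which makes \<open>x^2 - E\<close> positive, at most \<open>2 * x^2\<close>,
    and injective in \<open>k\<close>.\<close>
  define e where "e = u mod M + M * (\<bar>E\<bar> + 1)"
  have "\<bar>E\<bar> + 1 \<le> M * (\<bar>E\<bar> + 1)" using assms(1) by (simp add: int_one_le_iff_zero_less)
  then have e: "e > \<bar>E\<bar>" unfolding e_def using pos_mod_sign[OF assms(1), of u] by linarith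
  have eu: "[e = u] (mod M)" by (simp add: e_def cong_def)
  define x where "x k = e + M * int k" for k
  have xu: "[x k = u] (mod M)" for k using eu by (simp add: x_def cong_def)
  have xe: "x k \<ge> e" for k using assms(1) by (simp add: x_def)
  define h where "h k = (x k)\<^sup>2 - E" for k
  have xsq: "x k \<le> (x k)\<^sup>2" for k using xe[of k] e by (intro self_le_power) auto
  have pos: "h k > 0" for k using xsq[of k] xe[of k] e by (simp add: h_def)
  have copr: "coprime (h k) M" for k
  proof -
    have "[(x k)\<^sup>2 - E = u\<^sup>2 - E] (mod M)" using xu by (intro cong_diff cong_pow cong_refl)
    then show ?thesis unfolding h_def using assms(3) by (meson cong_imp_coprime cong_sym)
  qed
  have "2 dvd M" using bad[of 2] by simp
  have xdiff: "x k - x l = M * (int k - int l)" for k l by (simp add: x_def algebra_simps)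
  have "infinite {k. squarefree (h k)}"
  proof (rule infinite_squarefree_values)
    show "h k \<noteq> 0" for k using pos[of k] by simp
    show "\<bar>h k\<bar> \<le> (int (nat (2 * (e + M))) * (int k + 1))\<^sup>2" for k
    proof -
      have "h k \<le> 2 * (x k)\<^sup>2" using xsq[of k] xe[of k] e by (simp add: h_def)
      also have "\<dots> \<le> (2 * x k)\<^sup>2" by (simp add: power_mult_distrib)
      also have "\<dots> \<le> (2 * (e + M) * (int k + 1))\<^sup>2"
      proof (rule power_mono)
        show "2 * x k \<le> 2 * (e + M) * (int k + 1)"
          using e assms(1) by (simp add: x_def algebra_simps)
      qed (use xe[of k] e in simp)
      finally show ?thesis using pos[of k] e assms(1) by simp
    qed
    show "\<not> 2\<^sup>2 dvd h k" for k
    proof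
      assume "2\<^sup>2 dvd h k"
      then have "2 dvd h k" by (rule dvd_trans[rotated]) simp
      then show False using coprime_common_divisor[OF copr[of k], of 2] \<open>2 dvd M\<close> by simp
    qed
    fix q :: nat
    assume q: "prime q" "q \<noteq> 2"
    show "\<exists>r s. \<forall>k. (int q)\<^sup>2 dvd h k \<longrightarrow> k mod q\<^sup>2 = r \<or> k mod q\<^sup>2 = s"
    proof (cases "\<exists>k. (int q)\<^sup>2 dvd h k")
      case True
      then obtain i where i: "(int q)\<^sup>2 dvd h i" by blast
      have cq: "coprime ((int q)\<^sup>2) M"
        using i copr[of i] by (metis coprime_divisors dvd_refl)
      have "\<not> int q dvd M"
      proof
        assume "int q dvd M"
        moreover have "int q dvd (int q)\<^sup>2" by (simp add: power2_eq_square)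
        ultimately have "is_unit (int q)" using cq coprime_common_divisor by blast
        then show False using q(1) by simp
      qed
      then have nE: "\<not> int q dvd 2 * E" using bad[of "int q"] q by auto
      have same: "k mod q\<^sup>2 = l mod q\<^sup>2" if "(int q)\<^sup>2 dvd x k - x l" for k l
      proof (rule cong_nat_int_power2)
        have "(int q)\<^sup>2 dvd M * (int k - int l)" using that by (simp only: xdiff)
        then show "(int q)\<^sup>2 dvd int k - int l" using cq by (simp only: coprime_dvd_mult_right_iff)
      qed
      have roots: "(int q)\<^sup>2 dvd x k - x l \<or> (int q)\<^sup>2 dvd x k + x l"
        if "(int q)\<^sup>2 dvd h k" "(int q)\<^sup>2 dvd h l" for k l
        using square_roots_mod_prime_square[OF _ nE] that q by (simp add: h_def)
      show ?thesis
      proof (cases "\<exists>j. (int q)\<^sup>2 dvd h j \<and> \<not> (int q)\<^sup>2 dvd x j - x i")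
        case True
        then obtain j where j: "(int q)\<^sup>2 dvd h j" "\<not> (int q)\<^sup>2 dvd x j - x i" by blast
        have "k mod q\<^sup>2 = i mod q\<^sup>2 \<or> k mod q\<^sup>2 = j mod q\<^sup>2" if k: "(int q)\<^sup>2 dvd h k" for k
        proof (cases "(int q)\<^sup>2 dvd x k - x i")
          case False
          \<comment> \<open>Both \<open>x k\<close> and \<open>x j\<close> differ from
            \<open>x i\<close>, so both are its negative modulo \<open>q^2\<close>; hence two
            classes suffice.\<close>
          then have "(int q)\<^sup>2 dvd (x k + x i) - (x j + x i)"
            using roots[OF k i] roots[OF j(1) i] j(2) by (intro dvd_diff) auto
          then show ?thesis using same[of k j] by simp
        qed (use same in blast)
        then show ?thesis by blast
      next
        case False
        then show ?thesis using same by blast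
      qed
    qed blast
  qed
  moreover have "inj h"
  proof (rule injI)
    fix k l assume "h k = h l"
    then have "(x k)\<^sup>2 = (x l)\<^sup>2" by (simp add: h_def)
    moreover have "x k \<ge> 0" "x l \<ge> 0" using xe[of k] xe[of l] e by linarith+
    ultimately have "x k = x l" by (rule power2_eq_imp_eq)
    then show "k = l" using assms(1) by (simp add: x_def)
  qed
  ultimately have "infinite (h ` {k. squarefree (h k)})"
    by (meson finite_imageD inj_on_subset subset_UNIV)
  moreover have "h ` {k. squarefree (h k)}
      \<subseteq> {m. squarefree m \<and> (\<exists>x. [x = u] (mod M) \<and> m = x\<^sup>2 - E)}"
    using xu by (auto simp: h_def)
  ultimately show ?thesis by (meson finite_subset)
qed

text \<open>Pigeonhole: \<open>x^2\<close> and \<open>b + D * y^2\<close> each take (p+1)/2 residues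
  for arguments from 0 to (p-1)/2, too many to be disjoint.\<close>

lemma norm_form_surj_mod_prime:
  fixes D b :: int
  assumes "prime p" "p \<noteq> 2" "\<not> int p dvd D"
  shows "\<exists>x y. [x\<^sup>2 - D * y\<^sup>2 = b] (mod int p)"
proof -
  define m where "m = int p div 2"
  have p: "prime (int p)" "odd p" "p > 1"
    using assms(1,2) primes_dvd_imp_eq[of 2 p] prime_gt_1_nat by auto
  then have m: "int p = 2 * m + 1" "m \<ge> 0" by (auto simp: m_def elim!: oddE)
  define F where "F x = x\<^sup>2 mod int p" for x
  define G where "G y = (b + D * y\<^sup>2) mod int p" for y
  have sq_inj: "x = y" if "x \<in> {0..m}" "y \<in> {0..m}" "int p dvd x\<^sup>2 - y\<^sup>2" for x y :: int
  proof -
    have "x\<^sup>2 - y\<^sup>2 = (x - y) * (x + y)" by (simp add: power2_eq_square algebra_simps)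
    then have "int p dvd x - y \<or> int p dvd x + y"
      using that(3) p(1) by (simp add: prime_dvd_mult_iff)
    then show ?thesis
    proof
      assume "int p dvd x - y"
      moreover have "\<bar>x - y\<bar> < int p" using that(1,2) m by auto
      ultimately show ?thesis using dvd_imp_le_int[of "x - y" "int p"] by fastforce
    next
      assume "int p dvd x + y"
      moreover have "\<bar>x + y\<bar> < int p" using that(1,2) m by auto
      ultimately have "x + y = 0" using dvd_imp_le_int[of "x + y" "int p"] by fastforce
      then show ?thesis using that(1,2) by simp
    qed
  qed
  have "inj_on F {0..m}"
    by (rule inj_onI) (simp add: F_def sq_inj mod_eq_dvd_iff)
  moreover have "inj_on G {0..m}"
  proof (rule inj_onI)
    fix x y assume xy: "x \<in> {0..m}" "y \<in> {0..m}" "G x = G y"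
    then have "int p dvd D * (x\<^sup>2 - y\<^sup>2)" by (simp add: G_def mod_eq_dvd_iff algebra_simps)
    then have "int p dvd x\<^sup>2 - y\<^sup>2" using p(1) assms(3) by (simp add: prime_dvd_mult_iff)
    then show "x = y" using xy sq_inj by blast
  qed
  ultimately have cards: "card (F ` {0..m}) = nat (m + 1)" "card (G ` {0..m}) = nat (m + 1)"
    by (simp_all add: card_image)
  have "F ` {0..m} \<inter> G ` {0..m} \<noteq> {}"
  proof
    assume "F ` {0..m} \<inter> G ` {0..m} = {}"
    then have "card (F ` {0..m} \<union> G ` {0..m}) = 2 * nat (m + 1)"
      by (subst card_Un_disjoint) (simp_all add: cards)
    moreover have "F ` {0..m} \<union> G ` {0..m} \<subseteq> {0..<int p}"
      using p(3) by (auto simp: F_def G_def)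
    then have "card (F ` {0..m} \<union> G ` {0..m}) \<le> card {0..<int p}" by (intro card_mono) auto
    ultimately show False using m by simp
  qed
  then obtain x y where "F x = G y" by blast
  then have "int p dvd x\<^sup>2 - (b + D * y\<^sup>2)" by (simp add: F_def G_def mod_eq_dvd_iff)
  then have "[x\<^sup>2 - D * y\<^sup>2 = b] (mod int p)" by (simp add: cong_iff_dvd_diff algebra_simps)
  then show ?thesis by blast
qed

lemma not_dvd_imp_coprime:
  fixes a p :: int
  assumes "prime p" "\<not> p dvd a"
  shows "coprime a p"
  using prime_imp_coprime[OF assms] by (simp only: coprime_commute)

lemma not_cong_0_imp_coprime:
  fixes a :: int
  assumes "prime p" "\<not> [a = 0] (mod int p)"
  shows "coprime a (int p)"
  using assms by (intro not_dvd_imp_coprime) (simp_all add: cong_0_iff)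

section \<open>Twists of positive rank\<close>

text \<open>The curve with its addition law is never shown to be a group here, so the product is
  computed from the fold relation itself: \<open>\<one>\<close> is a result, and every result is
  \<open>\<one>\<close>.\<close>

lemma finprod_const_one:
  assumes "finite S" "\<one>\<^bsub>G\<^esub> \<in> carrier G" "\<one>\<^bsub>G\<^esub> \<otimes>\<^bsub>G\<^esub> \<one>\<^bsub>G\<^esub> = \<one>\<^bsub>G\<^esub>" "\<And>x. x \<in> S \<Longrightarrow> f x = \<one>\<^bsub>G\<^esub>"
  shows "finprod G f S = \<one>\<^bsub>G\<^esub>"
proof -
  let ?R = "foldSetD (carrier G) ((\<otimes>\<^bsub>G\<^esub>) \<circ> f) \<one>\<^bsub>G\<^esub>"
  have "(S, \<one>\<^bsub>G\<^esub>) \<in> ?R"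
    using assms(1,4)
  proof (induction S rule: finite_induct)
    case empty
    show ?case using assms(2) by (rule foldSetD.emptyI)
  next
    case (insert x A)
    have fx: "((\<otimes>\<^bsub>G\<^esub>) \<circ> f) x \<one>\<^bsub>G\<^esub> = \<one>\<^bsub>G\<^esub>" using insert.prems assms(3) by simp
    have "(insert x A, ((\<otimes>\<^bsub>G\<^esub>) \<circ> f) x \<one>\<^bsub>G\<^esub>) \<in> ?R"
      by (rule foldSetD.insertI) (use insert fx assms(2) in auto)
    then show ?case by (simp only: fx)
  qed
  moreover have "z = \<one>\<^bsub>G\<^esub>" if "(A, z) \<in> ?R" "A \<subseteq> S" for A z
    using that
  proof (induction rule: foldSetD.induct)
    case (insertI x A y)
    then have "y = \<one>\<^bsub>G\<^esub>" "f x = \<one>\<^bsub>G\<^esub>" using assms(4) by blast+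
    then show ?case using assms(3) by simp
  qed simp
  ultimately have "(THE z. (S, z) \<in> ?R) = \<one>\<^bsub>G\<^esub>" by blast
  then show ?thesis using assms(1) by (simp add: finprod_def foldD_def)
qed

text \<open>If at most the empty set were independent, the set of cardinalities would be
  \<open>{}\<close> or \<open>{0}\<close>, and both have supremum 0 in the naturals.\<close>

lemma nonempty_independent_of_rank_pos:
  assumes "group_rank G > 0"
  shows "\<exists>S. int_independent G S \<and> S \<noteq> {}"
proof (rule ccontr)
  assume contr: "\<nexists>S. int_independent G S \<and> S \<noteq> {}"
  have "{card S | S. int_independent G S} \<subseteq> {0}"
  proof
    fix n assume "n \<in> {card S | S. int_independent G S}"
    then obtain S where "n = card S" "int_independent G S" by blast
    moreover from this contr have "S = {}" by blast
    ultimately show "n \<in> {0}" by simp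
  qed
  then have "{card S | S. int_independent G S} = {} \<or> {card S | S. int_independent G S} = {0}"
    by (rule subset_singletonD)
  then have "group_rank G = 0"
    unfolding group_rank_def by (elim disjE) (simp_all only: Sup_nat_empty cSup_singleton)
  then show False using assms by simp
qed

text \<open>
  If all affine rational points had \<open>y = 0\<close>, they would be killed by 2. This way no associativity
  of the group law is needed.
\<close>

lemma affine_point_of_rank_pos:
  assumes "twist_rank g d > 0"
  shows "\<exists>x y. y \<noteq> 0 \<and> of_int d * y\<^sup>2 = poly g x"
proof (rule ccontr)
  assume contr: "\<nexists>x y. y \<noteq> 0 \<and> of_int d * y\<^sup>2 = poly g x"
  let ?G = "curve_group (of_int d) g"
  obtain S where S: "int_independent ?G S" "S \<noteq> {}"
    using nonempty_independent_of_rank_pos assms unfolding twist_rank_def by blast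
  have two: "P [^]\<^bsub>?G\<^esub> (2::int) = \<one>\<^bsub>?G\<^esub>" if "P \<in> S" for P
  proof -
    have "on_curve (of_int d) g P" using S(1) that by (auto simp: int_independent_def curve_group_def)
    then have "P = Infinity \<or> (\<exists>x. P = Affine x 0)"
      using contr by (cases P; simp) blast
    then have "curve_add (of_int d) g P P = Infinity" by auto
    then show ?thesis
      by (simp add: int_pow_def curve_group_def numeral_2_eq_2)
  qed
  have "finprod ?G (\<lambda>P. P [^]\<^bsub>?G\<^esub> (2::int)) S = \<one>\<^bsub>?G\<^esub>"
  proof (rule finprod_const_one)
    show "finite S" using S(1) by (simp add: int_independent_def)
    show "P [^]\<^bsub>?G\<^esub> (2::int) = \<one>\<^bsub>?G\<^esub>" if "P \<in> S" for P using that by (rule two)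
  qed (simp_all add: curve_group_def)
  \<comment> \<open>Independence is applied to the constant exponent 2, which would force
    \<open>S\<close> to be empty.\<close>
  then have "\<forall>P\<in>S. (2::int) = 0"
    using S(1) unfolding int_independent_def by (elim conjE allE[of _ "\<lambda>_. 2"]) simp
  then show False using S(2) by auto
qed

section \<open>The sign of the twist and the parity of its rank\<close>

lemma conductor_pos: "conductor g > 0"
  unfolding conductor_def by (rule prod_pos) (auto dest: prime_gt_0_nat)

text \<open>At each prime factor of \<open>N\<close> the symbol is 1, since \<open>d\<close> is 1
  modulo 8 or congruent to the square 1. What remains is the factor of the Kronecker symbol for a
  negative argument, which is -1 exactly when \<open>d < 0\<close>.\<close>

lemma quadratic_character_neg_eq_sgn:
  assumes "N > 0" "d \<noteq> 0" "[d = 1] (mod 8 * int N)"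
  shows "quadratic_character d (- int N) = sgn d"
proof -
  have "[d = 1] (mod 4)" using assms(3) by (rule cong_dvd_modulus) simp
  then have disc: "quadratic_disc d = d" by (simp add: quadratic_disc_def)
  have "kronecker_prime d q = 1" if "q \<in> prime_factors (- int N)" for q
  proof (cases "q = 2")
    case True
    have "[d = 1] (mod 8)" using assms(3) by (rule cong_dvd_modulus) simp
    then have "d mod 8 = 1" by (simp add: cong_def)
    then show ?thesis using True by (simp add: kronecker_prime_def) presburger
  next
    case False
    have q: "prime q" "q dvd int N" using that by (auto simp: prime_factors_dvd)
    then have dq: "[d = 1] (mod q)" using assms(3) by (auto intro: cong_dvd_modulus)
    have "\<not> [1 = 0] (mod q)" using prime_gt_1_int[OF q(1)] by (simp add: cong_iff_dvd_diff)
    then have "\<not> [d = 0] (mod q)" using dq by (meson cong_sym cong_trans)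
    moreover have "QuadRes q d" unfolding QuadRes_def
      by (rule exI[of _ 1]) (use dq cong_sym in simp)
    ultimately show ?thesis using False by (simp add: kronecker_prime_def Legendre_def)
  qed
  then have "(\<Prod>q\<in>prime_factors (- int N). kronecker_prime d q ^ multiplicity q (- int N)) = 1"
    by (intro prod.neutral) simp
  then show ?thesis
    using assms(1,2) by (simp add: quadratic_character_def kronecker_def disc sgn_if)
qed

lemma infinite_twists_with_point_monic:
  assumes "elliptic_cubic g" parity_conjecture
    and p: "prime p" "\<not> int p dvd 2 * int (conductor g)" and a: "\<not> [a = 0] (mod int p)"
  shows "infinite {d. squarefree d \<and> [d = a] (mod int p) \<and>
    (\<exists>x y. y \<noteq> 0 \<and> of_int d * y\<^sup>2 = poly g x)}" (is "infinite ?T")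
proof -
  define N where "N = conductor g"
  \<comment> \<open>The sign that \<open>d\<close> must have: multiplied by the parity sign of the
    rank of the untwisted curve it gives -1.\<close>
  define \<epsilon> :: int where "\<epsilon> = - ((- 1) ^ twist_rank g 1)"
  have eps: "\<epsilon> = 1 \<or> \<epsilon> = - 1" by (cases "even (twist_rank g 1)") (simp_all add: \<epsilon>_def)
  then have eps2: "\<epsilon> * \<epsilon> = 1" by auto
  have N: "N > 0" by (simp add: N_def conductor_pos)
  have pp: "prime (int p)" using p(1) by simp
  have "\<not> int p dvd 2" "\<not> int p dvd int N" using p(2) unfolding N_def by (blast intro: dvd_mult dvd_mult2)+
  then have "\<not> int p dvd 2 ^ 3" using pp prime_dvd_power by blast
  then have "\<not> int p dvd 2 ^ 3 * int N"
    using pp \<open>\<not> int p dvd int N\<close> by (simp only: prime_dvd_mult_iff) blast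
  then have "coprime (int p) (8 * int N)" by (intro prime_imp_coprime[OF pp]) simp
  then have cop: "coprime (8 * int N) (int p)" by (simp only: coprime_commute)
  \<comment> \<open>This is the class of the absolute value of \<open>d\<close>. As
    \<open>\<epsilon>\<close> squares to 1, \<open>\<epsilon> * e\<close> is 1 modulo
    \<open>8 * N\<close> and \<open>a\<close> modulo \<open>p\<close>.\<close>
  then obtain c where c: "[c = \<epsilon>] (mod 8 * int N)" "[c = \<epsilon> * a] (mod int p)"
    using binary_chinese_remainder_int by blast
  have "coprime c (8 * int N)"
    by (rule cong_imp_coprime[OF cong_sym[OF c(1)]]) (use eps in auto)
  moreover have "coprime c (int p)"
  proof (rule cong_imp_coprime[OF cong_sym[OF c(2)]])
    show "coprime (\<epsilon> * a) (int p)"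
      using eps not_cong_0_imp_coprime[OF p(1) a] by auto
  qed
  ultimately have "coprime c (8 * int N * int p)" by simp
  then have inf: "infinite {e. e > 0 \<and> squarefree e \<and> [e = c] (mod 8 * int N * int p)}"
    using N p(1) by (intro infinite_squarefree_linear) (auto dest: prime_gt_0_nat)
  have "\<epsilon> * e \<in> ?T" if e: "e > 0" "squarefree e" "[e = c] (mod 8 * int N * int p)" for e
  proof -
    let ?d = "\<epsilon> * e"
    have sq: "squarefree ?d" using eps e(2) by auto
    have "[e = c] (mod int p)" using e(3) by (rule cong_dvd_modulus) simp
    then have "[?d = \<epsilon> * (\<epsilon> * a)] (mod int p)" by (intro cong_scalar_left cong_trans[OF _ c(2)])
    then have da: "[?d = a] (mod int p)" by (simp add: eps2 flip: mult.assoc)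
    have "[e = c] (mod 8 * int N)" using e(3) by (rule cong_dvd_modulus) simp
    then have "[?d = \<epsilon> * \<epsilon>] (mod 8 * int N)" by (intro cong_scalar_left cong_trans[OF _ c(1)])
    then have d1: "[?d = 1] (mod 8 * int N)" by (simp add: eps2)
    have "coprime ?d (8 * int N)" by (rule cong_imp_coprime[OF cong_sym[OF d1]]) simp
    then have cd: "coprime ?d (2 * int N)" "coprime ?d (int N)"
      by (rule coprime_divisors[OF dvd_refl, rotated]; simp)+
    have "[?d = 1] (mod 4)" using d1 by (rule cong_dvd_modulus) simp
    then have disc: "quadratic_disc ?d = ?d" by (simp add: quadratic_disc_def)
    have nz: "?d \<noteq> 0" using eps e(1) by auto
    have "elliptic_cubic g \<and> squarefree ?d \<and> coprime ?d (2 * int N) \<and>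
        coprime (quadratic_disc ?d) (int N)"
      using assms(1) sq cd unfolding disc by (intro conjI)
    then have "(- 1) ^ twist_rank g ?d = (- 1) ^ twist_rank g 1 * quadratic_character ?d (- int N)"
      using assms(2) unfolding parity_conjecture_def N_def by blast
    also have "quadratic_character ?d (- int N) = sgn ?d"
      using N nz d1 by (rule quadratic_character_neg_eq_sgn)
    also have "sgn ?d = \<epsilon>" using eps e(1) by auto
    finally have "(- 1 :: int) ^ twist_rank g ?d = - (\<epsilon> * \<epsilon>)" by (simp add: \<epsilon>_def)
    then have "(- 1 :: int) ^ twist_rank g ?d = - 1" by (simp add: eps2)
    then have "twist_rank g ?d > 0" by (cases "twist_rank g ?d = 0") auto
    then have "\<exists>x y. y \<noteq> 0 \<and> of_int ?d * y\<^sup>2 = poly g x" by (rule affine_point_of_rank_pos)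
    then show ?thesis using sq da by blast
  qed
  then have "(\<lambda>e. \<epsilon> * e) ` {e. e > 0 \<and> squarefree e \<and> [e = c] (mod 8 * int N * int p)} \<subseteq> ?T"
    by blast
  moreover have "inj (\<lambda>e. \<epsilon> * e)" using eps by (auto simp: inj_def)
  ultimately show ?thesis using inf by (meson finite_imageD finite_subset inj_on_subset subset_UNIV)
qed

text \<open>The substitution X = c3 x, Y = c3 y makes the cubic monic without changing
  \<open>d\<close>: g(X) = c3^2 F(X / c3). The bound \<open>L\<close> is twice the conductor of
  \<open>g\<close>, so it serves all \<open>p\<close> and \<open>a\<close> at once.\<close>

lemma infinite_twists_with_point:
  fixes c0 c1 c2 c3 :: rat
  defines "F \<equiv> [:c0, c1, c2, c3:]"
  assumes "c3 \<noteq> 0" and sep: "rsquarefree (map_poly of_rat F :: complex poly)" and parity_conjecture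
  obtains L :: int where "L \<noteq> 0"
    "\<And>p a. prime p \<Longrightarrow> \<not> int p dvd L \<Longrightarrow> \<not> [a = 0] (mod int p) \<Longrightarrow>
      infinite {d. squarefree d \<and> [d = a] (mod int p) \<and> (\<exists>x y. y \<noteq> 0 \<and> of_int d * y\<^sup>2 = poly F x)}"
proof -
  define g where "g = [:c3\<^sup>2 * c0, c3 * c1, c2, 1:]"
  have gF: "poly g X = c3\<^sup>2 * poly F (X / c3)" for X
    using assms(2) by (simp add: g_def F_def field_simps power2_eq_square)
  have "rsquarefree (map_poly of_rat g :: complex poly)"
    unfolding rsquarefree_roots
  proof safe
    fix w :: complex
    assume w: "poly (map_poly of_rat g) w = 0" "poly (pderiv (map_poly of_rat g)) w = 0"
    define b0 b1 b2 b3 where b: "b0 = (of_rat c0 :: complex)" "b1 = (of_rat c1 :: complex)"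
      "b2 = (of_rat c2 :: complex)" "b3 = (of_rat c3 :: complex)"
    \<comment> \<open>A common root of \<open>g\<close> and its derivative scales back to one of
      \<open>F\<close> and its derivative.\<close>
    define z where "z = w / b3"
    have "b3 \<noteq> 0" using assms(2) by (simp add: b)
    then have wz: "w = b3 * z" by (simp add: z_def)
    have F: "map_poly of_rat F = [:b0, b1, b2, b3:]"
      by (simp add: F_def map_poly_pCons b)
    have g: "map_poly of_rat g = [:b3\<^sup>2 * b0, b3 * b1, b2, 1:]"
      by (simp add: g_def map_poly_pCons b of_rat_mult of_rat_power)
    have "poly (map_poly of_rat g) w = b3\<^sup>2 * poly [:b0, b1, b2, b3:] z"
      unfolding g wz by (simp add: algebra_simps power2_eq_square)
    then have F0: "poly (map_poly of_rat F) z = 0" using w(1) \<open>b3 \<noteq> 0\<close> F by simp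
    have "poly (pderiv (map_poly of_rat g)) w = b3 * poly (pderiv [:b0, b1, b2, b3:]) z"
      unfolding g wz by (simp add: pderiv_pCons algebra_simps power2_eq_square)
    then have F1: "poly (pderiv (map_poly of_rat F)) z = 0" using w(2) \<open>b3 \<noteq> 0\<close> F by simp
    show False using sep F0 F1 unfolding rsquarefree_roots by blast
  qed
  then have ell: "elliptic_cubic g" by (simp add: elliptic_cubic_def g_def)
  show thesis
  proof (rule that)
    show "2 * int (conductor g) \<noteq> 0" using conductor_pos[of g] by simp
    fix p :: nat and a :: int
    assume p: "prime p" "\<not> int p dvd 2 * int (conductor g)" and a: "\<not> [a = 0] (mod int p)"
    have "{d. squarefree d \<and> [d = a] (mod int p) \<and> (\<exists>x y. y \<noteq> 0 \<and> of_int d * y\<^sup>2 = poly g x)}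
        \<subseteq> {d. squarefree d \<and> [d = a] (mod int p) \<and> (\<exists>x y. y \<noteq> 0 \<and> of_int d * y\<^sup>2 = poly F x)}"
    proof safe
      fix d :: int and x y :: rat
      assume "y \<noteq> 0" "of_int d * y\<^sup>2 = poly g x"
      then have "y / c3 \<noteq> 0" "of_int d * (y / c3)\<^sup>2 = poly F (x / c3)"
        using assms(2) by (simp_all add: gF field_simps)
      then show "\<exists>x y. y \<noteq> 0 \<and> of_int d * y\<^sup>2 = poly F x" by blast
    qed
    then show "infinite {d. squarefree d \<and> [d = a] (mod int p) \<and>
        (\<exists>x y. y \<noteq> 0 \<and> of_int d * y\<^sup>2 = poly F x)}"
      using infinite_twists_with_point_monic[OF ell assms(4) p a] finite_subset by blast
  qed
qed

section \<open>Polynomials of degree 1, 2, 3 and 4\<close>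

lemma all_residues_for_almost_all_primesI:
  fixes L :: int
  assumes "L \<noteq> 0"
    and "\<And>p a. prime p \<Longrightarrow> \<not> int p dvd L \<Longrightarrow> \<not> [a = 0] (mod int p) \<Longrightarrow>
      infinite {s \<in> sqfree_values f. [s = a] (mod int p)}"
  shows "all_residues_for_almost_all_primes f"
  unfolding all_residues_for_almost_all_primes_def
proof (rule finite_subset)
  show "finite {p. p dvd nat \<bar>L\<bar>}" using assms(1) by (intro finite_divisors_nat) simp
qed (use assms(2) in \<open>auto simp: dvd_nat_abs_iff\<close>)

section \<open>Degrees 1 and 2, unconditionally\<close>

lemma all_residues_linear:
  fixes A C :: int
  assumes "A \<noteq> 0"
  shows "all_residues_for_almost_all_primes [:C, A:]"
proof (rule all_residues_for_almost_all_primesI)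
  fix p :: nat and a :: int
  assume p: "prime p" "\<not> int p dvd 2" and a: "\<not> [a = 0] (mod int p)"
  have "coprime 2 (int p)" using p by (intro not_dvd_imp_coprime) auto
  \<comment> \<open>Oddness is imposed because the sieve works with an even modulus.\<close>
  then obtain c where c: "[c = 1] (mod 2)" "[c = a] (mod int p)"
    using binary_chinese_remainder_int by blast
  have "coprime c 2" by (rule cong_imp_coprime[OF cong_sym[OF c(1)]]) simp
  moreover have "coprime c (int p)"
    by (rule cong_imp_coprime[OF cong_sym[OF c(2)] not_cong_0_imp_coprime[OF p(1) a]])
  ultimately have inf: "infinite {d. d > 0 \<and> squarefree d \<and> [d = c] (mod 2 * int p)}"
    using prime_gt_0_nat[OF p(1)] by (intro infinite_squarefree_linear) auto
  have "d \<in> sqfree_values [:C, A:] \<and> [d = a] (mod int p)"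
    if "squarefree d" "[d = c] (mod 2 * int p)" for d
  proof
    show "d \<in> sqfree_values [:C, A:]"
      by (rule sqfree_valuesI[of _ _ "(of_int d - of_int C) / of_int A" 1])
         (use assms that in \<open>simp_all add: map_poly_pCons\<close>)
    have "[d = c] (mod int p)" using that(2) by (rule cong_dvd_modulus) simp
    then show "[d = a] (mod int p)" using c(2) by (rule cong_trans)
  qed
  then have "{d. d > 0 \<and> squarefree d \<and> [d = c] (mod 2 * int p)}
      \<subseteq> {s \<in> sqfree_values [:C, A:]. [s = a] (mod int p)}" by blast
  then show "infinite {s \<in> sqfree_values [:C, A:]. [s = a] (mod int p)}"
    using inf finite_subset by blast
qed simp

text \<open>With r the argument on the left, 4 A v^2 f(r) = m. Hence f(r) and A m agree up to
  squares, and \<open>A\<close> may be replaced by \<open>A0\<close>.\<close>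

lemma quadratic_value_completing_square:
  fixes A B C :: "'a::field_char_0"
  assumes "A \<noteq> 0" "v \<noteq> 0" and A: "A = A0 * s\<^sup>2"
    and m: "m = z\<^sup>2 - (B\<^sup>2 - 4 * A * C) * v\<^sup>2"
  shows "poly [:C, B, A:] ((z / v - B) / (2 * A)) = A0 * m * (s / (2 * A * v))\<^sup>2"
proof -
  define r where "r = (z / v - B) / (2 * A)"
  have "2 * A * r + B = z / v" using assms(1) by (simp add: r_def)
  then have z: "z = (2 * A * r + B) * v" using assms(2) by simp
  have m': "m = poly [:C, B, A:] r * (4 * A * v\<^sup>2)"
    unfolding m z by (simp add: algebra_simps power2_eq_square)
  have "A0 * m * (s / (2 * A * v))\<^sup>2 = (A0 * s\<^sup>2) * m / (2 * A * v)\<^sup>2"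
    by (simp add: power_divide)
  also have "\<dots> = A * m / (2 * A * v)\<^sup>2" by (simp only: A)
  also have "\<dots> = poly [:C, B, A:] r * ((A * (4 * A * v\<^sup>2)) / (2 * A * v)\<^sup>2)"
    by (simp only: m' ac_simps times_divide_eq_right)
  also have "(A * (4 * A * v\<^sup>2)) / (2 * A * v)\<^sup>2 = 1"
    using assms(1,2) by (simp add: power2_eq_square)
  finally show ?thesis by (simp add: r_def)
qed

text \<open>
  Since \<open>4 A f(x) = (2 A x + B)\<^sup>2 - D\<close>, the squarefree parts of values of \<open>f\<close> are those of the
  numbers \<open>A (u\<^sup>2 - D v\<^sup>2)\<close>. With \<open>v\<close> fixed and a multiple of \<open>2 A D\<close>, and \<open>u \<equiv> 1\<close> modulo
  the prime factors of \<open>v\<close> other than \<open>p\<close>, the number \<open>u\<^sup>2 - D v\<^sup>2\<close> is coprime to \<open>2 A D v\<close> up to \<open>p\<close>.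
\<close>

lemma all_residues_quadratic:
  fixes A B C :: int
  assumes "A \<noteq> 0" and disc: "B\<^sup>2 - 4 * A * C \<noteq> 0"
  shows "all_residues_for_almost_all_primes [:C, B, A:]"
proof (rule all_residues_for_almost_all_primesI)
  define D where "D = B\<^sup>2 - 4 * A * C"
  define L where "L = 2 * \<bar>A\<bar> * \<bar>D\<bar>"
  show "L \<noteq> 0" using assms by (simp add: L_def D_def)
  then have "L > 0" by (simp add: L_def)
  define A0 where "A0 = squarefree_part A"
  define s where "s = square_part A"
  have A: "A = A0 * s\<^sup>2" unfolding A0_def s_def by (rule squarefree_decompose)
  have "s \<noteq> 0" using A assms(1) by auto
  have sqA0: "squarefree A0" by (simp add: A0_def)
  fix p :: nat and a :: int
  assume p: "prime p" "\<not> int p dvd L" and a: "\<not> [a = 0] (mod int p)"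
  have pp: "prime (int p)" using p(1) by simp
  have pD: "\<not> int p dvd D" "\<not> int p dvd A0" "p \<noteq> 2"
  proof -
    have "A0 dvd A" by (subst A) simp
    then have "A0 dvd L" "D dvd L" "2 dvd L" by (simp_all add: L_def dvd_mult dvd_mult2)
    then show "\<not> int p dvd D" "\<not> int p dvd A0" "p \<noteq> 2" using p(2) by (blast dest: dvd_trans, blast dest: dvd_trans, auto)
  qed
  \<comment> \<open>\<open>b\<close> is the residue that the norm form must hit, so that the factor
    \<open>A0\<close> carries it to \<open>a\<close>.\<close>
  obtain b where b: "[A0 * b = a] (mod int p)"
  proof -
    have "coprime A0 (int p)" using pp pD(2) by (rule not_dvd_imp_coprime)
    then obtain i where "[A0 * i = 1] (mod int p)" using cong_solve_coprime_int by blast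
    then have "[A0 * i * a = 1 * a] (mod int p)" by (rule cong_scalar_right)
    then show thesis using that[of "i * a"] by (simp add: mult.assoc)
  qed
  have b0: "\<not> int p dvd b"
  proof
    assume "int p dvd b"
    then have "int p dvd A0 * b" by simp
    then show False using cong_dvd_iff[OF b] a by (simp add: cong_0_iff)
  qed
  obtain x y where xy: "[x\<^sup>2 - D * y\<^sup>2 = b] (mod int p)"
    using norm_form_surj_mod_prime[OF p(1) pD(3,1)] by blast
  have "coprime L (int p)" using pp p(2) by (rule not_dvd_imp_coprime)
  then obtain i where i: "[L * i = 1] (mod int p)" using cong_solve_coprime_int by blast
  have p0: "int p > 0" using prime_gt_0_nat[OF p(1)] by simp
  \<comment> \<open>\<open>w\<close> represents \<open>i * y\<close>, so that \<open>L * w\<close>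
    is \<open>y\<close> modulo \<open>p\<close>. The residue 0 is represented by \<open>p\<close> to
    keep \<open>v\<close> nonzero.\<close>
  define w where "w = (if int p dvd i * y then int p else (i * y) mod int p)"
  \<comment> \<open>This is \<open>w\<close> freed of \<open>p\<close>, so that
    \<open>L * w'\<close> and \<open>p\<close> are coprime and the Chinese remainder theorem
    applies.\<close>
  define w' where "w' = (if int p dvd i * y then 1 else w)"
  have w: "w > 0" "[w = i * y] (mod int p)"
  proof -
    have "w > 0 \<and> [w = i * y] (mod int p)"
    proof (cases "int p dvd i * y")
      case True
      then have "[i * y = 0] (mod int p)" "w = int p" by (simp_all only: cong_0_iff w_def if_True)
      then show ?thesis using p0 by (simp add: cong_def)
    next
      case False
      then have "i * y mod int p \<noteq> 0" by (simp only: mod_eq_0_iff_dvd not_False_eq_True)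
      moreover have "i * y mod int p \<ge> 0" using p0 by simp
      moreover have "w = i * y mod int p" using False by (simp only: w_def if_False)
      ultimately show ?thesis by (simp add: cong_def)
    qed
    then show "w > 0" "[w = i * y] (mod int p)" by blast+
  qed
  have w': "w' > 0" "coprime w' (int p)" "w' dvd w"
  proof -
    show "w' > 0" "w' dvd w" using w(1) by (auto simp: w'_def)
    show "coprime w' (int p)"
    proof (cases "int p dvd i * y")
      case False
      then have "\<not> int p dvd w" using cong_dvd_iff[OF w(2)] by simp
      then show ?thesis using False not_dvd_imp_coprime[OF pp] by (simp add: w'_def)
    qed (simp add: w'_def)
  qed
  define v where "v = L * w"
  have "v > 0" using \<open>L > 0\<close> w(1) by (simp add: v_def)
  have vy: "[v = y] (mod int p)"
  proof -
    have "[L * w = L * (i * y)] (mod int p)" using w(2) by (rule cong_scalar_left)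
    also have "[L * (i * y) = 1 * y] (mod int p)"
      using cong_scalar_right[OF i, of y] by (simp add: mult.assoc)
    finally show ?thesis by (simp add: v_def)
  qed
  define M where "M = L * w' * int p"
  have "coprime (L * w') (int p)" using \<open>coprime L (int p)\<close> w'(2) by simp
  then obtain u where u: "[u = 1] (mod L * w')" "[u = x] (mod int p)"
    using binary_chinese_remainder_int by blast
  define E where "E = D * v\<^sup>2"
  have copr: "coprime (u\<^sup>2 - E) M"
  proof -
    have "L * w' dvd v" using w'(3) by (simp add: v_def mult_dvd_mono)
    \<comment> \<open>Modulo \<open>L * w'\<close> the term \<open>E\<close> vanishes and
      \<open>u\<close> is 1; modulo \<open>p\<close> the value is \<open>b\<close>, a unit.\<close>
    then have "[u\<^sup>2 - E = 1\<^sup>2 - 0] (mod L * w')"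
    proof (intro cong_diff cong_pow)
      show "[E = 0] (mod L * w')"
        using \<open>L * w' dvd v\<close> unfolding E_def cong_0_iff power2_eq_square by (intro dvd_mult)
    qed (rule u(1))
    then have "coprime (u\<^sup>2 - E) (L * w')"
      by (rule cong_imp_coprime[OF cong_sym]) simp
    moreover have "[u\<^sup>2 - E = x\<^sup>2 - D * y\<^sup>2] (mod int p)"
      unfolding E_def using u(2) vy by (intro cong_diff cong_mult cong_pow cong_refl)
    then have "[u\<^sup>2 - E = b] (mod int p)" using xy by (rule cong_trans)
    then have "coprime (u\<^sup>2 - E) (int p)"
      by (rule cong_imp_coprime[OF cong_sym])
         (rule not_dvd_imp_coprime[OF pp b0])
    ultimately show ?thesis by (simp add: M_def)
  qed
  have "infinite {m. squarefree m \<and> (\<exists>x. [x = u] (mod M) \<and> m = x\<^sup>2 - E)}"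
  proof (rule infinite_squarefree_quadratic)
    show "M > 0" using \<open>L > 0\<close> w'(1) p0 by (simp add: M_def)
    fix q :: int
    assume q: "prime q" "q dvd 2 * E"
    have "2 * E = 2 * D * v * v" by (simp add: E_def power2_eq_square)
    then have "q dvd 2 * D \<or> q dvd L \<or> q dvd w"
      using q by (simp only: prime_dvd_mult_iff v_def) blast
    moreover have "2 * D dvd L" by (simp add: L_def)
    ultimately have "q dvd L \<or> q dvd w" using dvd_trans by blast
    moreover have "w dvd w' * int p" by (simp add: w'_def w_def)
    ultimately show "q dvd M" unfolding M_def mult.assoc
      by (meson dvd_mult dvd_mult2 dvd_trans)
  qed (rule copr)
  moreover have "inj (\<lambda>m. A0 * m)" using sqA0 by (auto simp: inj_def)
  ultimately have "infinite ((\<lambda>m. A0 * m) ` {m. squarefree m \<and> (\<exists>x. [x = u] (mod M) \<and> m = x\<^sup>2 - E)})"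
    by (meson finite_imageD inj_on_subset subset_UNIV)
  moreover have "A0 * m \<in> sqfree_values [:C, B, A:] \<and> [A0 * m = a] (mod int p)"
    if m: "squarefree m" "[z = u] (mod M)" "m = z\<^sup>2 - E" for m z
  proof
    have mu: "[m = u\<^sup>2 - E] (mod M)" unfolding m(3) using m(2) by (intro cong_diff cong_pow cong_refl)
    have "coprime m M" by (rule cong_imp_coprime[OF cong_sym[OF mu] copr])
    moreover have "A0 dvd M" by (simp add: M_def L_def A)
    \<comment> \<open>The modulus contains \<open>A0\<close>, so multiplying by it creates no
      repeated prime factor.\<close>
    ultimately have "coprime A0 m" by (metis coprime_commute coprime_divisors dvd_refl)
    then have sq: "squarefree (A0 * m)" using sqA0 m(1) by (intro squarefree_mult_coprime)
    let ?r = "(of_int z / of_int v - of_int B) / (2 * of_int A) :: rat"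
    let ?q = "of_int s / (2 * of_int A * of_int v) :: rat"
    have nz: "(of_int v :: rat) \<noteq> 0" "(of_int A :: rat) \<noteq> 0" "(of_int s :: rat) \<noteq> 0"
      using \<open>v > 0\<close> assms(1) \<open>s \<noteq> 0\<close> by simp_all
    have "poly [:of_int C, of_int B, of_int A:] ?r = of_int A0 * of_int m * ?q\<^sup>2"
    proof (rule quadratic_value_completing_square[OF nz(2,1)])
      show "of_int A = (of_int A0 * (of_int s)\<^sup>2 :: rat)"
        by (subst A) (simp only: of_int_mult of_int_power)
      show "of_int m = ((of_int z)\<^sup>2 - ((of_int B)\<^sup>2 - 4 * of_int A * of_int C) * (of_int v)\<^sup>2 :: rat)"
        unfolding m(3) E_def D_def by simp
    qed
    then have "poly (map_poly of_int [:C, B, A:]) ?r = of_int (A0 * m) * ?q\<^sup>2"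
      by (simp add: map_poly_pCons)
    then show "A0 * m \<in> sqfree_values [:C, B, A:]"
      by (rule sqfree_valuesI[OF sq]) (use nz in simp)
    have "[m = u\<^sup>2 - E] (mod int p)" using mu by (rule cong_dvd_modulus) (simp add: M_def)
    also have "[u\<^sup>2 - E = x\<^sup>2 - D * y\<^sup>2] (mod int p)"
      unfolding E_def using u(2) vy by (intro cong_diff cong_mult cong_pow cong_refl)
    also note xy
    finally have "[A0 * m = A0 * b] (mod int p)" by (rule cong_scalar_left)
    then show "[A0 * m = a] (mod int p)" using b by (rule cong_trans)
  qed
  then have "(\<lambda>m. A0 * m) ` {m. squarefree m \<and> (\<exists>x. [x = u] (mod M) \<and> m = x\<^sup>2 - E)}
      \<subseteq> {s \<in> sqfree_values [:C, B, A:]. [s = a] (mod int p)}" by auto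
  ultimately show "infinite {s \<in> sqfree_values [:C, B, A:]. [s = a] (mod int p)}"
    using finite_subset by blast
qed

section \<open>Degrees 3 and 4, under the Parity Conjecture\<close>

lemma all_residues_cubic:
  fixes c0 c1 c2 c3 :: int
  defines "f \<equiv> [:c0, c1, c2, c3:]"
  assumes "c3 \<noteq> 0" "separable_int_poly f" parity_conjecture
  shows "all_residues_for_almost_all_primes f"
proof -
  have f: "map_poly of_int f = [:of_int c0, of_int c1, of_int c2, of_int c3 :: rat:]"
    by (simp add: f_def map_poly_pCons)
  have "rsquarefree (map_poly of_rat [:of_int c0, of_int c1, of_int c2, of_int c3:] :: complex poly)"
    using assms(3) by (simp add: separable_int_poly_def f_def map_poly_pCons)
  moreover have "(of_int c3 :: rat) \<noteq> 0" using assms(2) by simp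
  ultimately obtain L :: int where L: "L \<noteq> 0"
    "\<And>p a. prime p \<Longrightarrow> \<not> int p dvd L \<Longrightarrow> \<not> [a = 0] (mod int p) \<Longrightarrow>
      infinite {d. squarefree d \<and> [d = a] (mod int p) \<and>
        (\<exists>x y. y \<noteq> 0 \<and> of_int d * y\<^sup>2 = poly [:of_int c0, of_int c1, of_int c2, of_int c3 :: rat:] x)}"
    using infinite_twists_with_point[OF _ _ assms(4)] by blast
  show ?thesis
  proof (rule all_residues_for_almost_all_primesI[OF L(1)])
    fix p :: nat and a :: int
    assume p: "prime p" "\<not> int p dvd L" "\<not> [a = 0] (mod int p)"
    show "infinite {s \<in> sqfree_values f. [s = a] (mod int p)}"
    proof (rule infinite_super[OF _ L(2)[OF p]], safe)
      fix d :: int and x y :: rat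
      assume "squarefree d" and y: "y \<noteq> 0"
        and d: "of_int d * y\<^sup>2 = poly [:of_int c0, of_int c1, of_int c2, of_int c3:] x"
      then show "d \<in> sqfree_values f"
        by (intro sqfree_valuesI[OF _ _ y, of d f x]) (simp_all only: f)
    qed
  qed
qed

text \<open>The coefficients are the derivatives at \<open>r\<close> divided by factorials. The type
  is generic because the expansion is used over the rationals for values and over the complex
  numbers for separability.\<close>

lemma quartic_taylor:
  fixes a0 a1 a2 a3 a4 r s :: "'a::idom"
  defines "f \<equiv> [:a0, a1, a2, a3, a4:]"
    and "h1 \<equiv> a1 + 2 * a2 * r + 3 * a3 * r^2 + 4 * a4 * r^3"
    and "h2 \<equiv> a2 + 3 * a3 * r + 6 * a4 * r^2"
    and "h3 \<equiv> a3 + 4 * a4 * r"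
  shows "poly f (r + s) = poly f r + h1 * s + h2 * s^2 + h3 * s^3 + a4 * s^4"
    and "poly (pderiv f) (r + s) = h1 + 2 * h2 * s + 3 * h3 * s^2 + 4 * a4 * s^3"
    and "poly (pderiv f) r = h1"
  unfolding f_def h1_def h2_def h3_def
  by (simp_all add: pderiv_pCons algebra_simps power2_eq_square power3_eq_cube power4_eq_xxxx)

text \<open>
  For a root \<open>r\<close> of \<open>f\<close>, \<open>t\<^sup>4 f(r + 1/t)\<close> is a separable cubic in \<open>t\<close>. Its value at \<open>t = 0\<close>
  need not be a value of \<open>f\<close> up to squares, so one squarefree integer has to be discarded.
\<close>

lemma all_residues_quartic:
  fixes a0 a1 a2 a3 a4 :: int and r :: rat
  defines "f \<equiv> [:a0, a1, a2, a3, a4:]"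
  assumes "a4 \<noteq> 0" and sep: "separable_int_poly f" and parity_conjecture
    and root: "poly (map_poly of_int f) r = 0"
  shows "all_residues_for_almost_all_primes f"
proof -
  define h1 where "h1 = of_int a1 + 2 * of_int a2 * r + 3 * of_int a3 * r^2 + 4 * of_int a4 * r^3"
  define h2 where "h2 = of_int a2 + 3 * of_int a3 * r + 6 * of_int a4 * r^2"
  define h3 where "h3 = of_int a3 + 4 * of_int a4 * r"
  \<comment> \<open>The Taylor coefficients in reversed order: \<open>1 / t\<close> replaces the
    increment, and the constant term vanishes at the root.\<close>
  define F where "F = [:of_int a4, h3, h2, h1:]"
  have f: "map_poly of_int f = [:of_int a0, of_int a1, of_int a2, of_int a3, of_int a4 :: rat:]"
    by (simp add: f_def map_poly_pCons)
  have fF: "poly (map_poly of_int f) (r + 1 / t) = poly F t / t^4" if "t \<noteq> 0" for t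
  proof -
    have "poly (map_poly of_int f) (r + 1 / t)
        = h1 * (1 / t) + h2 * (1 / t)^2 + h3 * (1 / t)^3 + of_int a4 * (1 / t)^4"
      using root unfolding f quartic_taylor(1) h1_def h2_def h3_def by simp
    also have "\<dots> = poly F t / t^4"
      using that by (simp add: F_def field_simps power2_eq_square power3_eq_cube power4_eq_xxxx)
    finally show ?thesis .
  qed
  define \<rho> :: complex where "\<rho> = of_rat r"
  define k1 where "k1 = of_int a1 + 2 * of_int a2 * \<rho> + 3 * of_int a3 * \<rho>^2 + 4 * of_int a4 * \<rho>^3"
  define k2 where "k2 = of_int a2 + 3 * of_int a3 * \<rho> + 6 * of_int a4 * \<rho>^2"
  define k3 where "k3 = of_int a3 + 4 * of_int a4 * \<rho>"
  have k: "of_rat h1 = k1" "of_rat h2 = k2" "of_rat h3 = k3"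
    by (simp_all add: h1_def h2_def h3_def k1_def k2_def k3_def \<rho>_def of_rat_add of_rat_mult of_rat_power)
  have fc: "map_poly of_int f = [:of_int a0, of_int a1, of_int a2, of_int a3, of_int a4 :: complex:]"
    by (simp add: f_def map_poly_pCons)
  have sep': "\<not> (poly (map_poly of_int f) z = 0 \<and> poly (pderiv (map_poly of_int f)) z = 0)"
    for z :: complex
    using sep unfolding separable_int_poly_def rsquarefree_roots by blast
  have "poly (map_poly of_int f) \<rho> = of_rat (poly (map_poly of_int f) r)"
    unfolding f fc \<rho>_def by (simp add: of_rat_add of_rat_mult)
  then have rootc: "poly (map_poly of_int f) \<rho> = 0" using root by simp
  \<comment> \<open>The root is simple, so the derivative there, which is the leading coefficient of
    \<open>F\<close>, does not vanish.\<close>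
  then have "k1 \<noteq> 0" using sep'[of \<rho>] quartic_taylor(3)
    unfolding fc k1_def by metis
  then have "h1 \<noteq> 0" using k(1) by auto
  moreover have "rsquarefree (map_poly of_rat F :: complex poly)"
    unfolding rsquarefree_roots
  proof safe
    fix z :: complex
    assume z: "poly (map_poly of_rat F) z = 0" "poly (pderiv (map_poly of_rat F)) z = 0"
    have F: "map_poly of_rat F = [:of_int a4, k3, k2, k1:]"
      by (simp add: F_def map_poly_pCons k)
    have z0: "of_int a4 + k3 * z + k2 * z^2 + k1 * z^3 = 0"
      using z(1) by (simp add: F algebra_simps power2_eq_square power3_eq_cube)
    have z1: "k3 + 2 * k2 * z + 3 * k1 * z^2 = 0"
      using z(2) by (simp add: F pderiv_pCons algebra_simps power2_eq_square)
    have "z \<noteq> 0" using z0 assms(2) by auto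
    have "poly (map_poly of_int f) (\<rho> + 1 / z)
        = k1 * (1 / z) + k2 * (1 / z)^2 + k3 * (1 / z)^3 + of_int a4 * (1 / z)^4"
      using rootc unfolding fc quartic_taylor(1) k1_def k2_def k3_def by simp
    also have "\<dots> = (of_int a4 + k3 * z + k2 * z^2 + k1 * z^3) / z^4"
      using \<open>z \<noteq> 0\<close> by (simp add: field_simps power2_eq_square power3_eq_cube power4_eq_xxxx)
    finally have f0: "poly (map_poly of_int f) (\<rho> + 1 / z) = 0" by (simp add: z0)
    have "poly (pderiv (map_poly of_int f)) (\<rho> + 1 / z)
        = k1 + 2 * k2 * (1 / z) + 3 * k3 * (1 / z)^2 + 4 * of_int a4 * (1 / z)^3"
      unfolding fc quartic_taylor(2) k1_def k2_def k3_def by simp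
    \<comment> \<open>Differentiating F(t) = t^4 f(r + 1/t) gives t^3 f'(r + 1/t) = 4 F(t) - t
      F'(t), so a double root of \<open>F\<close> yields one of \<open>f\<close>.\<close>
    also have "\<dots> = (4 * (of_int a4 + k3 * z + k2 * z^2 + k1 * z^3)
        - z * (k3 + 2 * k2 * z + 3 * k1 * z^2)) / z^3"
      using \<open>z \<noteq> 0\<close> by (simp add: field_simps power2_eq_square power3_eq_cube)
    finally have "poly (pderiv (map_poly of_int f)) (\<rho> + 1 / z) = 0" by (simp add: z0 z1)
    then show False using f0 sep' by blast
  qed
  ultimately obtain L :: int where L: "L \<noteq> 0"
    "\<And>p a. prime p \<Longrightarrow> \<not> int p dvd L \<Longrightarrow> \<not> [a = 0] (mod int p) \<Longrightarrow>
      infinite {d. squarefree d \<and> [d = a] (mod int p) \<and> (\<exists>x y. y \<noteq> 0 \<and> of_int d * y\<^sup>2 = poly F x)}"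
    using infinite_twists_with_point[OF _ _ assms(4)] unfolding F_def by blast
  show ?thesis
  proof (rule all_residues_for_almost_all_primesI[OF L(1)])
    fix p :: nat and a :: int
    assume p: "prime p" "\<not> int p dvd L" "\<not> [a = 0] (mod int p)"
    let ?T = "{d. squarefree d \<and> [d = a] (mod int p) \<and> (\<exists>x y. y \<noteq> 0 \<and> of_int d * y\<^sup>2 = poly F x)}"
    have "infinite (?T - {sqfree_part_rat (of_int a4)})" using L(2)[OF p] by simp
    moreover have "?T - {sqfree_part_rat (of_int a4)} \<subseteq> {s \<in> sqfree_values f. [s = a] (mod int p)}"
    proof
      fix d assume d: "d \<in> ?T - {sqfree_part_rat (of_int a4)}"
      then obtain t y where ty: "squarefree d" "y \<noteq> 0" "of_int d * y\<^sup>2 = poly F t" by blast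
      \<comment> \<open>At \<open>t = 0\<close> the cubic takes the value \<open>a4\<close>, whose
        squarefree part was removed.\<close>
      have "t \<noteq> 0"
      proof
        assume "t = 0"
        then have "of_int a4 = of_int d * y\<^sup>2" using ty(3) by (simp add: F_def)
        then have "sqfree_part_rat (of_int a4) = d" by (rule sqfree_part_rat_eqI[OF ty(1) _ ty(2)])
        then show False using d by simp
      qed
      then have "poly (map_poly of_int f) (r + 1 / t) = of_int d * (y / t\<^sup>2)\<^sup>2"
        unfolding fF[OF \<open>t \<noteq> 0\<close>] ty(3)[symmetric]
        by (simp add: power_divide flip: power_mult)
      then have "d \<in> sqfree_values f"
        by (rule sqfree_valuesI[OF ty(1)]) (use ty(2) \<open>t \<noteq> 0\<close> in simp)
      then show "d \<in> {s \<in> sqfree_values f. [s = a] (mod int p)}" using d by blast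
    qed
    ultimately show "infinite {s \<in> sqfree_values f. [s = a] (mod int p)}"
      using finite_subset by blast
  qed
qed

section \<open>Assembly by degree\<close>

lemma poly_eq_coeffs_degree_le_4:
  assumes "degree f \<le> 4"
  shows "f = [:coeff f 0, coeff f 1, coeff f 2, coeff f 3, coeff f 4:]"
proof (rule poly_eqI)
  fix n
  consider "n = 0" | "n = 1" | "n = 2" | "n = 3" | "n = 4" | m where "n = Suc (Suc (Suc (Suc (Suc m))))"
    by (metis One_nat_def Suc_1 not0_implies_Suc numeral_3_eq_3 numeral_eq_Suc pred_numeral_simps(2) semiring_norm(26,27))
  then show "coeff f n = coeff [:coeff f 0, coeff f 1, coeff f 2, coeff f 3, coeff f 4:] n"
    by cases (use assms in \<open>simp_all add: numeral_eq_Suc coeff_eq_0\<close>)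
qed

text \<open>If the discriminant vanished, -B/(2A) would be a double root.\<close>

lemma separable_quadratic_disc_nonzero:
  fixes A B C :: int
  assumes "A \<noteq> 0" "separable_int_poly [:C, B, A:]"
  shows "B\<^sup>2 - 4 * A * C \<noteq> 0"
proof
  assume "B\<^sup>2 - 4 * A * C = 0"
  then have "of_int (B\<^sup>2 - 4 * A * C) = (0::complex)" by (simp only: of_int_0)
  then have D: "(of_int B)\<^sup>2 = (4 * of_int A * of_int C :: complex)" by simp
  define z :: complex where "z = - of_int B / (2 * of_int A)"
  have B: "of_int B = - 2 * of_int A * z" using assms(1) by (simp add: z_def)
  have "4 * of_int A * of_int C = (- 2 * of_int A * z)\<^sup>2"
    using D unfolding B by (rule sym)
  also have "\<dots> = 4 * of_int A * (of_int A * z\<^sup>2)"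
    by (simp add: power2_eq_square algebra_simps)
  finally have C: "of_int C = of_int A * z\<^sup>2" using assms(1) by simp
  have f: "map_poly of_int [:C, B, A:] = [:of_int C, of_int B, of_int A :: complex:]"
    by (simp add: map_poly_pCons)
  have "poly (map_poly of_int [:C, B, A:]) z = 0"
    unfolding f by (simp add: C B power2_eq_square algebra_simps)
  moreover have "poly (pderiv (map_poly of_int [:C, B, A:])) z = 0"
    unfolding f by (simp add: B pderiv_pCons algebra_simps)
  ultimately show False
    using assms(2) unfolding separable_int_poly_def rsquarefree_roots by blast
qed

theorem theorem1p3:
  fixes f :: "int poly"
  assumes "separable_int_poly f" and "degree f > 0"
  shows "(degree f = 1 \<or> degree f = 2 \<longrightarrow> all_residues_for_almost_all_primes f) \<and>
    (degree f = 3 \<or> (degree f = 4 \<and> (\<exists>r::rat. poly (map_poly of_int f) r = 0)) \<longrightarrow>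
       parity_conjecture \<longrightarrow> all_residues_for_almost_all_primes f)"
proof (intro conjI impI)
  have lc: "coeff f (degree f) \<noteq> 0" using assms(2) by auto
  {
    assume "degree f = 1 \<or> degree f = 2"
    then show "all_residues_for_almost_all_primes f"
    proof
      assume d: "degree f = 1"
      then have f: "f = [:coeff f 0, coeff f 1:]"
        using poly_eq_coeffs_degree_le_4[of f] by (simp add: coeff_eq_0)
      show ?thesis by (subst f, rule all_residues_linear) (use lc d in simp)
    next
      assume d: "degree f = 2"
      then have f: "f = [:coeff f 0, coeff f 1, coeff f 2:]"
        using poly_eq_coeffs_degree_le_4[of f] by (simp add: coeff_eq_0)
      have A: "coeff f 2 \<noteq> 0" using lc d by simp
      show ?thesis
        by (subst f, rule all_residues_quadratic[OF A separable_quadratic_disc_nonzero[OF A]])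
           (use assms(1) f in argo)
    qed
  }
  assume par: parity_conjecture
  assume "degree f = 3 \<or> (degree f = 4 \<and> (\<exists>r::rat. poly (map_poly of_int f) r = 0))"
  then show "all_residues_for_almost_all_primes f"
  proof (elim disjE conjE exE)
    assume d: "degree f = 3"
    then have f: "f = [:coeff f 0, coeff f 1, coeff f 2, coeff f 3:]"
      using poly_eq_coeffs_degree_le_4[of f] by (simp add: coeff_eq_0)
    have "coeff f 3 \<noteq> 0" using lc d by simp
    then show ?thesis
      using all_residues_cubic[of "coeff f 3" "coeff f 0" "coeff f 1" "coeff f 2"] assms(1) par
      by (simp only: f[symmetric] simp_thms)
  next
    fix r :: rat
    assume d: "degree f = 4" and r: "poly (map_poly of_int f) r = 0"
    then have f: "f = [:coeff f 0, coeff f 1, coeff f 2, coeff f 3, coeff f 4:]"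
      using poly_eq_coeffs_degree_le_4[of f] by simp
    have "coeff f 4 \<noteq> 0" using lc d by simp
    then show ?thesis
      using all_residues_quartic[of "coeff f 4" "coeff f 0" "coeff f 1" "coeff f 2" "coeff f 3" r]
        assms(1) par r
      by (simp only: f[symmetric] simp_thms)
  qed
qed

end
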